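(* For a Leibniz algebra $\mathfrak{q}$ over $\mathbb{K}$ the following statements are equivalent: (a) $\mathfrak{q}$ is $\mathrm{Lie}$-unicentral. (b) The map $C:Z_{\mathrm{Lie}}(\mathfrak{q})\otimes\mathfrak{q}_{\mathrm{Lie}}\to HL^{\mathrm{Lie}}_2(\mathfrak{q})$, the first map of the six-term exact sequence $$Z_{\mathrm{Lie}}(\mathfrak{q})\otimes\mathfrak{q}_{\mathrm{Lie}}\stackrel{C}{\to}HL^{\mathrm{Lie}}_2(\mathfrak{q})\to HL^{\mathrm{Lie}}_2(\mathfrak{q}/Z_{\mathrm{Lie}}(\mathfrak{q}))\to Z_{\mathrm{Lie}}(\mathfrak{q})\to\mathfrak{q}_{\mathrm{Lie}}\to(\mathfrak{q}/Z_{\mathrm{Lie}}(\mathfrak{q}))_{\mathrm{Lie}}\to0$$ associated to the $\mathrm{Lie}$-central extension $0\to Z_{\mathrm{Lie}}(\mathfrak{q})\to\mathfrak{q}\to\mathfrak{q}/Z_{\mathrm{Lie}}(\mathfrak{q})\to0$, is the zero map. (c) The canonical homomorphism $HL^{\mathrm{Lie}}_2(\mathfrak{q})\to HL^{\mathrm{Lie}}_2(\mathfrak{q}/Z_{\mathrm{Lie}}(\mathfrak{q}))$ is injective.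
   Context: $\mathbb{K}$ is a field with $\frac12\in\mathbb{K}$; tensor products are over $\mathbb{K}$. A Leibniz algebra is a $\mathbb{K}$-vector space with a bilinear bracket satisfying $[x,[y,z]]=[[x,y],z]-[[x,z],y]$. $\mathfrak{q}^{\mathrm{ann}}$ is the span of all $[x,x]$ (a two-sided ideal), $\mathfrak{q}_{\mathrm{Lie}}=\mathfrak{q}/\mathfrak{q}^{\mathrm{ann}}$. For two-sided ideals $\mathfrak{m},\mathfrak{n}$ of $\mathfrak{q}$, $[\mathfrak{m},\mathfrak{n}]_{\mathrm{Lie}}$ is the span of all $[m,n]+[n,m]$, $m\in\mathfrak{m}$, $n\in\mathfrak{n}$. The $\mathrm{Lie}$-center is $Z_{\mathrm{Lie}}(\mathfrak{q})=\{z\in\mathfrak{q}\mid[x,z]+[z,x]=0\ \forall x\in\mathfrak{q}\}$ (a two-sided ideal). A $\mathrm{Lie}$-central extension is a surjective homomorphism $f:\mathfrak{g}\twoheadrightarrow\mathfrak{q}$ of Leibniz algebras with $\ker f\subseteq Z_{\mathrm{Lie}}(\mathfrak{g})$. $\mathfrak{q}$ is $\mathrm{Lie}$-unicentral if every $\mathrm{Lie}$-central extension $f:\mathfrak{g}\twoheadrightarrow\mathfrak{q}$ satisfies $f(Z_{\mathrm{Lie}}(\mathfrak{g}))=Z_{\mathrm{Lie}}(\mathfrak{q})$. For a free presentation $0\to\mathfrak{r}\to\mathfrak{f}\stackrel{\rho}{\to}\mathfrak{q}\to0$ ($\mathfrak{f}$ a free Leibniz algebra), $HL^{\mathrm{Lie}}_2(\mathfrak{q})=(\mathfrak{r}\cap[\mathfrak{f},\mathfrak{f}]_{\mathrm{Lie}})/[\mathfrak{r},\mathfrak{f}]_{\mathrm{Lie}}$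 (independent of the presentation up to canonical isomorphism). With $\mathfrak{a}=Z_{\mathrm{Lie}}(\mathfrak{q})$, $\pi:\mathfrak{q}\to\mathfrak{q}/\mathfrak{a}$ the projection and $\mathfrak{s}=\ker(\pi\circ\rho)$, the canonical map $HL^{\mathrm{Lie}}_2(\mathfrak{q})\to HL^{\mathrm{Lie}}_2(\mathfrak{q}/\mathfrak{a})=(\mathfrak{s}\cap[\mathfrak{f},\mathfrak{f}]_{\mathrm{Lie}})/[\mathfrak{s},\mathfrak{f}]_{\mathrm{Lie}}$ is induced by $\mathfrak{r}\subseteq\mathfrak{s}$, and $C$ is given by $C(a\otimes\overline{x})=[s,y]+[y,s]+[\mathfrak{r},\mathfrak{f}]_{\mathrm{Lie}}$, where $s\in\mathfrak{s}$, $y\in\mathfrak{f}$ satisfy $\rho(s)=a$, $\rho(y)=x$.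
   Formalization: The formula for C need not be well defined on Z_Lie(q)⊗q_Lie for every q (it can be nonzero on [x,x]); (b) is therefore read as "C is well defined and is the zero map", which agrees with the original (b) whenever C exists. *)

theory Defs
  imports "HOL-Algebra.Module" "HOL-Algebra.AbelCoset"
begin

section \<open>Vector spaces\<close>

text \<open>A vector space over the field \<open>K\<close> is a \<^locale>\<open>module\<close> over \<open>K\<close>. The ring
  multiplication and the unit that a module record inherits play no role and stay unspecified.\<close>

definition span :: "('k, 'r) ring_scheme \<Rightarrow> ('k, 'a, 'm) module_scheme \<Rightarrow> 'a set \<Rightarrow> 'a set"
  where "span K M S = \<Inter>{H. submodule H K M \<and> S \<subseteq> H}"

definition linear_maps ::
  "('k, 'r) ring_scheme \<Rightarrow> ('k, 'a, 'm) module_scheme \<Rightarrow> ('k, 'b, 'n) module_scheme \<Rightarrow> ('a \<Rightarrow> 'b) set"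
  where "linear_maps K M N =
    {h. h \<in> carrier M \<rightarrow> carrier N \<and>
        (\<forall>x\<in>carrier M. \<forall>y\<in>carrier M. h (x \<oplus>\<^bsub>M\<^esub> y) = h x \<oplus>\<^bsub>N\<^esub> h y) \<and>
        (\<forall>k\<in>carrier K. \<forall>x\<in>carrier M. h (k \<odot>\<^bsub>M\<^esub> x) = k \<odot>\<^bsub>N\<^esub> h x)}"

definition quot_space :: "('k, 'a, 'm) module_scheme \<Rightarrow> 'a set \<Rightarrow> ('k, 'a set) module"
  where "quot_space M I =
    \<lparr>carrier = a_rcosets\<^bsub>M\<^esub> I, mult = undefined, one = undefined,
     zero = I, add = set_add M, smult = (\<lambda>k A. \<Union>x\<in>A. I +>\<^bsub>M\<^esub> (k \<odot>\<^bsub>M\<^esub> x))\<rparr>"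

definition free_space :: "('k, 'r) ring_scheme \<Rightarrow> 'b set \<Rightarrow> ('k, 'b \<Rightarrow> 'k) module"
  where "free_space K B =
    \<lparr>carrier = {c. (\<forall>b. c b \<in> carrier K) \<and> (\<forall>b. b \<notin> B \<longrightarrow> c b = \<zero>\<^bsub>K\<^esub>) \<and>
                  finite {b. c b \<noteq> \<zero>\<^bsub>K\<^esub>}},
     mult = undefined, one = undefined,
     zero = (\<lambda>b. \<zero>\<^bsub>K\<^esub>), add = (\<lambda>c d b. c b \<oplus>\<^bsub>K\<^esub> d b), smult = (\<lambda>k c b. k \<otimes>\<^bsub>K\<^esub> c b)\<rparr>"

definition basis_vec :: "('k, 'r) ring_scheme \<Rightarrow> 'b \<Rightarrow> 'b \<Rightarrow> 'k"
  where "basis_vec K b = (\<lambda>b'. if b' = b then \<one>\<^bsub>K\<^esub> else \<zero>\<^bsub>K\<^esub>)"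

definition tensor_relations ::
  "('k, 'r) ring_scheme \<Rightarrow> ('k, 'a, 'm) module_scheme \<Rightarrow> ('k, 'b, 'n) module_scheme \<Rightarrow>
    ('a \<times> 'b \<Rightarrow> 'k) set"
  where "tensor_relations K M N =
    (let V = free_space K (carrier M \<times> carrier N); e = basis_vec K in
      {e (x \<oplus>\<^bsub>M\<^esub> x', y) \<ominus>\<^bsub>V\<^esub> (e (x, y) \<oplus>\<^bsub>V\<^esub> e (x', y)) | x x' y.
          x \<in> carrier M \<and> x' \<in> carrier M \<and> y \<in> carrier N} \<union>
      {e (x, y \<oplus>\<^bsub>N\<^esub> y') \<ominus>\<^bsub>V\<^esub> (e (x, y) \<oplus>\<^bsub>V\<^esub> e (x, y')) | x y y'.
          x \<in> carrier M \<and> y \<in> carrier N \<and> y' \<in> carrier N} \<union>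
      {e (k \<odot>\<^bsub>M\<^esub> x, y) \<ominus>\<^bsub>V\<^esub> k \<odot>\<^bsub>V\<^esub> e (x, y) | k x y.
          k \<in> carrier K \<and> x \<in> carrier M \<and> y \<in> carrier N} \<union>
      {e (x, k \<odot>\<^bsub>N\<^esub> y) \<ominus>\<^bsub>V\<^esub> k \<odot>\<^bsub>V\<^esub> e (x, y) | k x y.
          k \<in> carrier K \<and> x \<in> carrier M \<and> y \<in> carrier N})"

definition tensor_kernel ::
  "('k, 'r) ring_scheme \<Rightarrow> ('k, 'a, 'm) module_scheme \<Rightarrow> ('k, 'b, 'n) module_scheme \<Rightarrow>
    ('a \<times> 'b \<Rightarrow> 'k) set"
  where "tensor_kernel K M N =
    span K (free_space K (carrier M \<times> carrier N)) (tensor_relations K M N)"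

definition tensor_space ::
  "('k, 'r) ring_scheme \<Rightarrow> ('k, 'a, 'm) module_scheme \<Rightarrow> ('k, 'b, 'n) module_scheme \<Rightarrow>
    ('k, ('a \<times> 'b \<Rightarrow> 'k) set) module"
  where "tensor_space K M N =
    quot_space (free_space K (carrier M \<times> carrier N)) (tensor_kernel K M N)"

definition pure_tensor ::
  "('k, 'r) ring_scheme \<Rightarrow> ('k, 'a, 'm) module_scheme \<Rightarrow> ('k, 'b, 'n) module_scheme \<Rightarrow>
    'a \<Rightarrow> 'b \<Rightarrow> ('a \<times> 'b \<Rightarrow> 'k) set"
  where "pure_tensor K M N x y =
    tensor_kernel K M N +>\<^bsub>free_space K (carrier M \<times> carrier N)\<^esub> basis_vec K (x, y)"


section \<open>Leibniz algebras\<close>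

record ('k, 'a) leibniz = "('k, 'a) module" +
  bracket :: "'a \<Rightarrow> 'a \<Rightarrow> 'a" (\<open>\<langle>_,/ _\<rangle>\<index>\<close>)

locale leibniz_algebra = K?: field K + L?: module K L
  for K (structure) and L :: "('k, 'a, 'm) leibniz_scheme" (structure) +
  assumes bracket_closed:
      "\<lbrakk>x \<in> carrier L; y \<in> carrier L\<rbrakk> \<Longrightarrow> \<langle>x, y\<rangle>\<^bsub>L\<^esub> \<in> carrier L"
    and bracket_add_left:
      "\<lbrakk>x \<in> carrier L; y \<in> carrier L; z \<in> carrier L\<rbrakk> \<Longrightarrow>
        \<langle>x \<oplus>\<^bsub>L\<^esub> y, z\<rangle>\<^bsub>L\<^esub> = \<langle>x, z\<rangle>\<^bsub>L\<^esub> \<oplus>\<^bsub>L\<^esub> \<langle>y, z\<rangle>\<^bsub>L\<^esub>"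
    and bracket_add_right:
      "\<lbrakk>x \<in> carrier L; y \<in> carrier L; z \<in> carrier L\<rbrakk> \<Longrightarrow>
        \<langle>x, y \<oplus>\<^bsub>L\<^esub> z\<rangle>\<^bsub>L\<^esub> = \<langle>x, y\<rangle>\<^bsub>L\<^esub> \<oplus>\<^bsub>L\<^esub> \<langle>x, z\<rangle>\<^bsub>L\<^esub>"
    and bracket_smult_left:
      "\<lbrakk>k \<in> carrier K; x \<in> carrier L; y \<in> carrier L\<rbrakk> \<Longrightarrow>
        \<langle>k \<odot>\<^bsub>L\<^esub> x, y\<rangle>\<^bsub>L\<^esub> = k \<odot>\<^bsub>L\<^esub> \<langle>x, y\<rangle>\<^bsub>L\<^esub>"
    and bracket_smult_right:
      "\<lbrakk>k \<in> carrier K; x \<in> carrier L; y \<in> carrier L\<rbrakk> \<Longrightarrow>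
        \<langle>x, k \<odot>\<^bsub>L\<^esub> y\<rangle>\<^bsub>L\<^esub> = k \<odot>\<^bsub>L\<^esub> \<langle>x, y\<rangle>\<^bsub>L\<^esub>"
    and leibniz_identity:
      "\<lbrakk>x \<in> carrier L; y \<in> carrier L; z \<in> carrier L\<rbrakk> \<Longrightarrow>
        \<langle>x, \<langle>y, z\<rangle>\<^bsub>L\<^esub>\<rangle>\<^bsub>L\<^esub> = \<langle>\<langle>x, y\<rangle>\<^bsub>L\<^esub>, z\<rangle>\<^bsub>L\<^esub> \<ominus>\<^bsub>L\<^esub> \<langle>\<langle>x, z\<rangle>\<^bsub>L\<^esub>, y\<rangle>\<^bsub>L\<^esub>"

definition leibniz_hom ::
  "('k, 'r) ring_scheme \<Rightarrow> ('k, 'a, 'm) leibniz_scheme \<Rightarrow> ('k, 'b, 'n) leibniz_scheme \<Rightarrow>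
    ('a \<Rightarrow> 'b) set"
  where "leibniz_hom K L M =
    {h \<in> linear_maps K L M.
      \<forall>x\<in>carrier L. \<forall>y\<in>carrier L. h \<langle>x, y\<rangle>\<^bsub>L\<^esub> = \<langle>h x, h y\<rangle>\<^bsub>M\<^esub>}"

definition leibniz_quot :: "('k, 'a, 'm) leibniz_scheme \<Rightarrow> 'a set \<Rightarrow> ('k, 'a set) leibniz"
  where "leibniz_quot L I =
    module.extend (quot_space L I)
      (leibniz.fields (\<lambda>A B. \<Union>x\<in>A. \<Union>y\<in>B. I +>\<^bsub>L\<^esub> \<langle>x, y\<rangle>\<^bsub>L\<^esub>))"

definition Lie_center :: "('k, 'a, 'm) leibniz_scheme \<Rightarrow> 'a set"
  where "Lie_center L =
    {z \<in> carrier L. \<forall>x\<in>carrier L. \<langle>x, z\<rangle>\<^bsub>L\<^esub> \<oplus>\<^bsub>L\<^esub> \<langle>z, x\<rangle>\<^bsub>L\<^esub> = \<zero>\<^bsub>L\<^esub>}"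

definition Lie_commutator ::
  "('k, 'r) ring_scheme \<Rightarrow> ('k, 'a, 'm) leibniz_scheme \<Rightarrow> 'a set \<Rightarrow> 'a set \<Rightarrow> 'a set"
  where "Lie_commutator K L M N =
    span K L {\<langle>m, n\<rangle>\<^bsub>L\<^esub> \<oplus>\<^bsub>L\<^esub> \<langle>n, m\<rangle>\<^bsub>L\<^esub> | m n. m \<in> M \<and> n \<in> N}"

definition leibniz_ann :: "('k, 'r) ring_scheme \<Rightarrow> ('k, 'a, 'm) leibniz_scheme \<Rightarrow> 'a set"
  where "leibniz_ann K L = span K L {\<langle>x, x\<rangle>\<^bsub>L\<^esub> | x. x \<in> carrier L}"


section \<open>Free Leibniz algebras\<close>

datatype (gens: 'x) magma = Gen 'x | Prod "'x magma" "'x magma"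

text \<open>The free nonassociative algebra on \<open>X\<close>: the vector space on the free magma on \<open>X\<close>, with
  the bilinear extension of the magma product. A nonassociative monomial of degree at least two
  has exactly one factorization, which gives the coefficients of a product.\<close>

definition nonassoc_algebra :: "('k, 'r) ring_scheme \<Rightarrow> 'x set \<Rightarrow> ('k, 'x magma \<Rightarrow> 'k) leibniz"
  where "nonassoc_algebra K X =
    module.extend (free_space K {m. gens m \<subseteq> X})
      (leibniz.fields
        (\<lambda>c d m. case m of Gen x \<Rightarrow> \<zero>\<^bsub>K\<^esub> | Prod a b \<Rightarrow> c a \<otimes>\<^bsub>K\<^esub> d b))"

definition leibniz_ideal ::
  "('k, 'r) ring_scheme \<Rightarrow> ('k, 'a, 'm) leibniz_scheme \<Rightarrow> 'a set \<Rightarrow> bool"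
  where "leibniz_ideal K L I \<longleftrightarrow> submodule I K L \<and>
    (\<forall>x\<in>carrier L. \<forall>i\<in>I. \<langle>x, i\<rangle>\<^bsub>L\<^esub> \<in> I \<and> \<langle>i, x\<rangle>\<^bsub>L\<^esub> \<in> I)"

definition free_leibniz_ideal :: "('k, 'r) ring_scheme \<Rightarrow> 'x set \<Rightarrow> ('x magma \<Rightarrow> 'k) set"
  where "free_leibniz_ideal K X =
    (let A = nonassoc_algebra K X in
      \<Inter>{I. leibniz_ideal K A I \<and>
        (\<forall>x\<in>carrier A. \<forall>y\<in>carrier A. \<forall>z\<in>carrier A.
          \<langle>x, \<langle>y, z\<rangle>\<^bsub>A\<^esub>\<rangle>\<^bsub>A\<^esub> \<ominus>\<^bsub>A\<^esub> (\<langle>\<langle>x, y\<rangle>\<^bsub>A\<^esub>, z\<rangle>\<^bsub>A\<^esub> \<ominus>\<^bsub>A\<^esub> \<langle>\<langle>x, z\<rangle>\<^bsub>A\<^esub>, y\<rangle>\<^bsub>A\<^esub>) \<in> I)})"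

definition free_leibniz :: "('k, 'r) ring_scheme \<Rightarrow> 'x set \<Rightarrow> ('k, ('x magma \<Rightarrow> 'k) set) leibniz"
  where "free_leibniz K X = leibniz_quot (nonassoc_algebra K X) (free_leibniz_ideal K X)"

text \<open>A Leibniz algebra is free on a subset \<open>X\<close> if the canonical map from the free Leibniz
  algebra constructed on \<open>X\<close> is an isomorphism. Unlike the universal property, this does not
  refer to a type in which the test algebras live.\<close>

definition free_on :: "('k, 'r) ring_scheme \<Rightarrow> ('k, 'a, 'm) leibniz_scheme \<Rightarrow> 'a set \<Rightarrow> bool"
  where "free_on K L X \<longleftrightarrow> X \<subseteq> carrier L \<and>
    (\<exists>h \<in> leibniz_hom K (free_leibniz K X) L.
      bij_betw h (carrier (free_leibniz K X)) (carrier L) \<and>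
      (\<forall>x\<in>X. h (free_leibniz_ideal K X +>\<^bsub>nonassoc_algebra K X\<^esub> basis_vec K (Gen x)) = x))"

definition free_presentation ::
  "('k, 'r) ring_scheme \<Rightarrow> ('k, 'f, 'm) leibniz_scheme \<Rightarrow> ('k, 'a, 'n) leibniz_scheme \<Rightarrow>
    ('f \<Rightarrow> 'a) \<Rightarrow> bool"
  where "free_presentation K F Q \<rho> \<longleftrightarrow>
    leibniz_algebra K F \<and> (\<exists>X. free_on K F X) \<and>
    \<rho> \<in> leibniz_hom K F Q \<and> \<rho> ` carrier F = carrier Q"


section \<open>The second Lie-homology and the maps out of and into it\<close>

text \<open>For a free presentation \<open>\<rho>\<close> of \<open>Q\<close> by \<open>F\<close> with kernel \<open>R\<close>, the space
  \<open>(R \<inter> [F,F]) / [R,F]\<close>, where the brackets denote Lie-commutators.\<close>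

definition HL2_Lie ::
  "('k, 'r) ring_scheme \<Rightarrow> ('k, 'f, 'm) leibniz_scheme \<Rightarrow> ('k, 'a, 'n) leibniz_scheme \<Rightarrow>
    ('f \<Rightarrow> 'a) \<Rightarrow> ('k, 'f set) module"
  where "HL2_Lie K F Q \<rho> =
    (let R = a_kernel F Q \<rho> in
      quot_space (F\<lparr>carrier := R \<inter> Lie_commutator K F (carrier F) (carrier F)\<rparr>)
        (Lie_commutator K F R (carrier F)))"

definition center_quot :: "('k, 'a, 'm) leibniz_scheme \<Rightarrow> ('k, 'a set) leibniz"
  where "center_quot Q = leibniz_quot Q (Lie_center Q)"

definition center_proj :: "('k, 'a, 'm) leibniz_scheme \<Rightarrow> 'a \<Rightarrow> 'a set"
  where "center_proj Q x = Lie_center Q +>\<^bsub>Q\<^esub> x"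

text \<open>The presentation \<open>\<rho>\<close> of \<open>Q\<close> followed by the projection presents the quotient of \<open>Q\<close> by
  its Lie-center. Its kernel \<open>S\<close> contains the kernel \<open>R\<close> of \<open>\<rho>\<close>, and the canonical map sends
  \<open>[R,F] + x\<close> to \<open>[S,F] + x\<close>.\<close>

definition HL2_canonical_map ::
  "('k, 'r) ring_scheme \<Rightarrow> ('k, 'f, 'm) leibniz_scheme \<Rightarrow> ('k, 'a, 'n) leibniz_scheme \<Rightarrow>
    ('f \<Rightarrow> 'a) \<Rightarrow> 'f set \<Rightarrow> 'f set"
  where "HL2_canonical_map K F Q \<rho> A =
    (let S = a_kernel F (center_quot Q) (center_proj Q \<circ> \<rho>) in
      \<Union>x\<in>A. Lie_commutator K F S (carrier F) +>\<^bsub>F\<^esub> x)"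

text \<open>\<open>C\<close> is the linear map on the tensor product of the Lie-center of \<open>Q\<close> and
  \<open>Q / Q\<^sup>a\<^sup>n\<^sup>n\<close> with \<open>C (\<rho> s \<otimes> [\<rho> y]) = [s,y] + [y,s] + [R,F]\<close>. As pure tensors span, at
  most one map on the carrier satisfies this. The right-hand side need not depend only on the
  class of \<open>\<rho> y\<close> modulo \<open>Q\<^sup>a\<^sup>n\<^sup>n\<close>: for \<open>F\<close> free on \<open>w, s\<close> and \<open>R\<close> the ideal generated by
  \<open>[F,s] + [s,F]\<close>, the choice \<open>y = [w,w]\<close> gives \<open>[[w,w],s]\<close>, which is not in \<open>[R,F]\<close>. That
  \<open>C\<close> is the zero map therefore includes that the formula defines a map at all.\<close>

definition is_Ganea_map ::
  "('k, 'r) ring_scheme \<Rightarrow> ('k, 'f, 'm) leibniz_scheme \<Rightarrow> ('k, 'a, 'n) leibniz_scheme \<Rightarrow>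
    ('f \<Rightarrow> 'a) \<Rightarrow> (('a \<times> 'a set \<Rightarrow> 'k) set \<Rightarrow> 'f set) \<Rightarrow> bool"
  where "is_Ganea_map K F Q \<rho> C \<longleftrightarrow>
    (let Z = Q\<lparr>carrier := Lie_center Q\<rparr>;
         QLie = leibniz_quot Q (leibniz_ann K Q);
         R = a_kernel F Q \<rho>;
         S = a_kernel F (center_quot Q) (center_proj Q \<circ> \<rho>)
     in C \<in> linear_maps K (tensor_space K Z QLie) (HL2_Lie K F Q \<rho>) \<and>
        (\<forall>s\<in>S. \<forall>y\<in>carrier F.
          C (pure_tensor K Z QLie (\<rho> s) (leibniz_ann K Q +>\<^bsub>Q\<^esub> \<rho> y)) =
            Lie_commutator K F R (carrier F) +>\<^bsub>F\<^esub> (\<langle>s, y\<rangle>\<^bsub>F\<^esub> \<oplus>\<^bsub>F\<^esub> \<langle>y, s\<rangle>\<^bsub>F\<^esub>)))"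

definition Ganea_map_zero ::
  "('k, 'r) ring_scheme \<Rightarrow> ('k, 'f, 'm) leibniz_scheme \<Rightarrow> ('k, 'a, 'n) leibniz_scheme \<Rightarrow>
    ('f \<Rightarrow> 'a) \<Rightarrow> bool"
  where "Ganea_map_zero K F Q \<rho> \<longleftrightarrow>
    (\<exists>C. is_Ganea_map K F Q \<rho> C \<and>
      (\<forall>t \<in> carrier (tensor_space K (Q\<lparr>carrier := Lie_center Q\<rparr>)
                      (leibniz_quot Q (leibniz_ann K Q))).
        C t = \<zero>\<^bsub>HL2_Lie K F Q \<rho>\<^esub>))"


section \<open>Lie-unicentral Leibniz algebras\<close>

definition Lie_central_extension ::
  "('k, 'r) ring_scheme \<Rightarrow> ('k, 'g, 'm) leibniz_scheme \<Rightarrow> ('k, 'a, 'n) leibniz_scheme \<Rightarrow>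
    ('g \<Rightarrow> 'a) \<Rightarrow> bool"
  where "Lie_central_extension K G Q f \<longleftrightarrow>
    leibniz_algebra K G \<and> leibniz_algebra K Q \<and>
    f \<in> leibniz_hom K G Q \<and> f ` carrier G = carrier Q \<and> a_kernel G Q f \<subseteq> Lie_center G"

definition Lie_unicentral_in ::
  "'g itself \<Rightarrow> ('k, 'r) ring_scheme \<Rightarrow> ('k, 'a) leibniz \<Rightarrow> bool"
  where "Lie_unicentral_in T K Q \<longleftrightarrow>
    (\<forall>(G :: ('k, 'g) leibniz) f. Lie_central_extension K G Q f \<longrightarrow>
      f ` Lie_center G = Lie_center Q)"

text \<open>A formula cannot quantify over all types of extensions. The type chosen here holds the
  quotients of the free Leibniz algebra on the underlying set of \<open>Q\<close>, in particular its quotient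
  by \<open>[R,F]\<close> for the canonical presentation. If the extension given by that quotient satisfies
  the condition, then so does every Lie-central extension, on any type.\<close>

definition Lie_unicentral :: "('k, 'r) ring_scheme \<Rightarrow> ('k, 'a) leibniz \<Rightarrow> bool"
  where "Lie_unicentral K Q \<longleftrightarrow> Lie_unicentral_in TYPE(('a magma \<Rightarrow> 'k) set set) K Q"

end

theory Submission
  imports Defs
begin

text \<open>
  Let \<open>\<rho>\<close> be a free presentation of \<open>Q\<close> by \<open>F\<close> with kernel \<open>R\<close>, and let \<open>S\<close> be the preimage of the
  Lie-center \<open>Z\<close> of \<open>Q\<close>. Brackets of two subspaces denote Lie-commutators. As \<open>[Z,Q] = 0\<close>,
  there are inclusions \<open>[R,F] \<subseteq> [S,F] \<subseteq> R \<inter> [F,F]\<close>. All three statements of the theorem are equivalent to the single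
  condition \<open>[S,F] = [R,F]\<close>, that is, \<open>[S,F] \<subseteq> [R,F]\<close>.

  For the map on homology this is immediate: its kernel is \<open>[S,F] / [R,F]\<close>
  (\<open>HL2_canonical_map_inj_iff\<close>). The map on the tensor product takes the classes of the generators
  \<open>[s,y] + [y,s]\<close> of \<open>[S,F]\<close> as values on pure tensors, so it is zero, and then in particular well
  defined, precisely when these generators lie in \<open>[R,F]\<close> (\<open>Ganea_map_zero_iff\<close>).

  For unicentrality, suppose \<open>[S,F] \<subseteq> [R,F]\<close> and let \<open>f : G \<rightarrow> Q\<close> be a Lie-central extension. The
  presentation lifts to \<open>\<phi> : F \<rightarrow> G\<close>, which kills \<open>[R,F]\<close> because \<open>\<phi>\<close> maps \<open>R\<close> into the Lie-center
  of \<open>G\<close>. Hence it kills \<open>[S,F]\<close>, and \<open>\<phi>\<close> maps \<open>S\<close> into the Lie-center of \<open>G\<close>, which therefore maps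
  onto \<open>Z\<close> (\<open>image_Lie_center_eq_if_lift\<close>). Conversely, \<open>[R,F]\<close> is a two-sided ideal
  (\<open>Lie_commutator_ideal\<close>), and \<open>F / [R,F]\<close> is a Lie-central extension of \<open>Q\<close>. If its Lie-center maps
  onto \<open>Z\<close>, then each \<open>s \<in> S\<close> is congruent modulo \<open>R\<close> to an element \<open>z\<close> with
  \<open>[z,y] + [y,z] \<in> [R,F]\<close> for all \<open>y \<in> F\<close>, and \<open>[S,F] \<subseteq> [R,F]\<close> follows (\<open>center_commutator_subset_if_unicentral\<close>).

  The first half works for extensions on any type, the second tests only the extension
  \<open>F / [R,F]\<close>. Applied to the canonical presentation by the free Leibniz algebra on the underlying set
  of \<open>Q\<close>, they show that unicentrality for the one type in its definition implies unicentrality for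
  all types; the type of \<open>F / [R,F]\<close> for the given presentation is one of them.

  Lifting requires the universal property of the free Leibniz algebra as constructed from the free
  magma, which is obtained by extending the evaluation of monomials linearly and factoring through the
  ideal generated by the defects of the Leibniz identity.
\<close>

section \<open>Linear maps and quotient spaces\<close>

lemma (in abelian_group) minus_zero_right: "x \<in> carrier G \<Longrightarrow> x \<ominus> \<zero> = x"
  using add.inv_solve_right'[of x x \<zero>] by (simp add: a_minus_def)

lemma (in abelian_group) minus_zero: "\<ominus> \<zero> = \<zero>"
  using minus_zero_right[of \<zero>] by (simp add: a_minus_def)

lemma (in abelian_group) minus_eq_zero_iff:
  "x \<in> carrier G \<Longrightarrow> y \<in> carrier G \<Longrightarrow> x \<ominus> y = \<zero> \<longleftrightarrow> x = y"
  using add.inv_solve_right'[of \<zero> x y] by (simp add: a_minus_def)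

lemma (in abelian_group) add_diff_add:
  assumes "a \<in> carrier G" "b \<in> carrier G" "c \<in> carrier G" "d \<in> carrier G"
  shows "(a \<oplus> b) \<ominus> (c \<oplus> d) = (a \<ominus> c) \<oplus> (b \<ominus> d)"
proof -
  have "(a \<oplus> b) \<ominus> (c \<oplus> d) = a \<oplus> (b \<oplus> (\<ominus> c \<oplus> \<ominus> d))"
    using assms by (simp add: a_minus_def minus_add a_assoc)
  also have "b \<oplus> (\<ominus> c \<oplus> \<ominus> d) = \<ominus> c \<oplus> (b \<oplus> \<ominus> d)"
    using assms by (intro a_lcomm) auto
  finally show ?thesis using assms by (simp add: a_minus_def a_assoc)
qed

lemma linear_maps_closed: "h \<in> linear_maps K M N \<Longrightarrow> x \<in> carrier M \<Longrightarrow> h x \<in> carrier N"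
  and linear_maps_add: "h \<in> linear_maps K M N \<Longrightarrow> x \<in> carrier M \<Longrightarrow> y \<in> carrier M \<Longrightarrow>
    h (x \<oplus>\<^bsub>M\<^esub> y) = h x \<oplus>\<^bsub>N\<^esub> h y"
  and linear_maps_smult: "h \<in> linear_maps K M N \<Longrightarrow> k \<in> carrier K \<Longrightarrow> x \<in> carrier M \<Longrightarrow>
    h (k \<odot>\<^bsub>M\<^esub> x) = k \<odot>\<^bsub>N\<^esub> h x"
  by (auto simp: linear_maps_def)

lemma linear_maps_zero:
  assumes "module K M" "module K N" "h \<in> linear_maps K M N"
  shows "h \<zero>\<^bsub>M\<^esub> = \<zero>\<^bsub>N\<^esub>"
proof -
  interpret M: module K M by fact
  interpret N: module K N by fact
  have "h \<zero>\<^bsub>M\<^esub> = \<zero>\<^bsub>K\<^esub> \<odot>\<^bsub>N\<^esub> h \<zero>\<^bsub>M\<^esub>"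
    using linear_maps_smult[OF assms(3), of "\<zero>\<^bsub>K\<^esub>" "\<zero>\<^bsub>M\<^esub>"] by simp
  then show ?thesis
    using linear_maps_closed[OF assms(3)] by simp
qed

lemma linear_maps_minus:
  assumes "module K M" "module K N" "h \<in> linear_maps K M N" "x \<in> carrier M" "y \<in> carrier M"
  shows "h (x \<ominus>\<^bsub>M\<^esub> y) = h x \<ominus>\<^bsub>N\<^esub> h y"
proof -
  interpret M: module K M by fact
  interpret N: module K N by fact
  have inK: "\<ominus>\<^bsub>K\<^esub> \<one>\<^bsub>K\<^esub> \<in> carrier K" by simp
  have "h (\<ominus>\<^bsub>M\<^esub> y) = \<ominus>\<^bsub>N\<^esub> h y"
    using linear_maps_smult[OF assms(3) inK assms(5)] assms(5) linear_maps_closed[OF assms(3,5)]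
    by (simp add: M.smult_l_minus N.smult_l_minus)
  then show ?thesis
    using linear_maps_add[OF assms(3), of x "\<ominus>\<^bsub>M\<^esub> y"] assms(4,5) by (simp add: a_minus_def)
qed

lemma linear_maps_vimage_submodule:
  assumes "module K M" "module K N" "h \<in> linear_maps K M N" and H: "submodule H K N"
  shows "submodule {x \<in> carrier M. h x \<in> H} K M"
proof -
  interpret M: module K M by fact
  interpret N: module K N by fact
  have zero: "h \<zero>\<^bsub>M\<^esub> \<in> H"
    using subgroup.one_closed[OF submodule.axioms(1)[OF H]] linear_maps_zero[OF assms(1-3)] by simp
  show ?thesis
  proof (rule M.submoduleI)
    fix x assume x: "x \<in> {x \<in> carrier M. h x \<in> H}"
    then have "h (\<zero>\<^bsub>M\<^esub> \<ominus>\<^bsub>M\<^esub> x) \<in> H"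
      using N.submoduleE(3,5)[OF H] zero
      by (simp add: linear_maps_minus[OF assms(1-3)] N.M.minus_eq)
    then show "\<ominus>\<^bsub>M\<^esub> x \<in> {x \<in> carrier M. h x \<in> H}"
      using x by (simp add: M.M.minus_eq)
  qed (use zero in \<open>auto simp: linear_maps_add[OF assms(3)] linear_maps_smult[OF assms(3)]
      N.submoduleE[OF H]\<close>)
qed

lemma linear_maps_kernel_submodule:
  assumes "module K M" "module K N" "h \<in> linear_maps K M N"
  shows "submodule {x \<in> carrier M. h x = \<zero>\<^bsub>N\<^esub>} K M"
proof -
  interpret N: module K N by fact
  have "submodule {\<zero>\<^bsub>N\<^esub>} K N"
    by (rule N.submoduleI) (simp_all add: N.M.minus_zero)
  then show ?thesis
    using linear_maps_vimage_submodule[OF assms, of "{\<zero>\<^bsub>N\<^esub>}"] by simp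
qed

text \<open>The axioms of a module pass to any surjective linear image. Applied to the projection onto
  cosets, this replaces a computation with cosets for each axiom of a quotient; only the
  compatibility of the projection with the operations remains. The codomain is not yet known to
  be a module, so that zero goes to zero has to be assumed.\<close>

lemma module_image:
  assumes "module K M" and h: "h \<in> linear_maps K M N"
    and surj: "h ` carrier M = carrier N" and zero: "h \<zero>\<^bsub>M\<^esub> = \<zero>\<^bsub>N\<^esub>"
  shows "module K N"
proof -
  interpret M: module K M by fact
  note hom = linear_maps_add[OF h, symmetric] linear_maps_smult[OF h, symmetric]
    zero[symmetric]
  have mem: "x \<in> carrier N \<longleftrightarrow> (\<exists>a\<in>carrier M. x = h a)" for x
    using surj by auto
  show ?thesis
  proof (rule moduleI)
    show "cring K" by (rule M.R.is_cring)
    show "abelian_group N"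
    proof (rule abelian_groupI)
      fix x assume "x \<in> carrier N"
      then obtain a where a: "a \<in> carrier M" "x = h a" using mem by auto
      then have "h (\<ominus>\<^bsub>M\<^esub> a) \<oplus>\<^bsub>N\<^esub> x = \<zero>\<^bsub>N\<^esub>" by (simp add: hom M.M.l_neg)
      then show "\<exists>y\<in>carrier N. y \<oplus>\<^bsub>N\<^esub> x = \<zero>\<^bsub>N\<^esub>"
        using a mem by blast
    qed (auto simp: mem hom M.M.a_ac intro: M.M.a_closed M.zero_closed)
  qed (auto simp: mem hom M.smult_l_distr M.smult_r_distr M.smult_assoc1
      intro: M.smult_closed)
qed

context module
begin

lemma submodule_abelian_subgroup:
  assumes "submodule I R M"
  shows "abelian_subgroup I M"
  using assms by (intro abelian_subgroupI3 additive_subgroupI submodule.axioms M.abelian_group_axioms)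

lemma coset_eq_iff:
  assumes "submodule I R M" "x \<in> carrier M" "y \<in> carrier M"
  shows "I +>\<^bsub>M\<^esub> x = I +>\<^bsub>M\<^esub> y \<longleftrightarrow> x \<ominus>\<^bsub>M\<^esub> y \<in> I"
proof -
  interpret I: abelian_subgroup I M using assms(1) by (rule submodule_abelian_subgroup)
  show ?thesis
    using I.a_rcos_module[of y x] I.a_repr_independence'[of x y] I.a_rcos_self[of x] assms(2,3)
    by (metis a_minus_def)
qed

lemma coset_eq_self_iff:
  assumes "submodule I R M" "x \<in> carrier M"
  shows "I +>\<^bsub>M\<^esub> x = I \<longleftrightarrow> x \<in> I"
proof -
  have "I +>\<^bsub>M\<^esub> \<zero>\<^bsub>M\<^esub> = I"
    using submoduleE(1)[OF assms(1)] by simp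
  then show ?thesis
    using coset_eq_iff[OF assms(1,2) M.zero_closed] assms(2)
    by (simp add: M.minus_zero_right)
qed

text \<open>Operations of a quotient are defined by unions over all representatives. Such a union collapses
  to its value at one representative as soon as the summand depends only on the coset.\<close>

lemma coset_saturated:
  assumes I: "submodule I R M" and x: "x \<in> carrier M"
    and const: "\<And>y. y \<in> carrier M \<Longrightarrow> y \<ominus>\<^bsub>M\<^esub> x \<in> I \<Longrightarrow> f y = f x"
  shows "(\<Union>y\<in>I +>\<^bsub>M\<^esub> x. f y) = f x"
proof -
  interpret I: abelian_subgroup I M using I by (rule submodule_abelian_subgroup)
  have "f y = f x" if "y \<in> I +>\<^bsub>M\<^esub> x" for y
    using that I.a_rcos_module[of x y] I.a_elemrcos_carrier[OF x that] const x
    by (simp add: a_minus_def)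
  then show ?thesis using I.a_rcos_self[OF x] by blast
qed

lemma quot_space_linear:
  assumes I: "submodule I R M"
  shows "(\<lambda>x. I +>\<^bsub>M\<^esub> x) \<in> linear_maps R M (quot_space M I)"
proof -
  interpret I: abelian_subgroup I M using I by (rule submodule_abelian_subgroup)
  have "(\<Union>y\<in>I +>\<^bsub>M\<^esub> x. I +>\<^bsub>M\<^esub> (k \<odot>\<^bsub>M\<^esub> y)) = I +>\<^bsub>M\<^esub> (k \<odot>\<^bsub>M\<^esub> x)"
    if "k \<in> carrier R" "x \<in> carrier M" for k x
  proof (rule coset_saturated[OF I that(2)])
    fix y assume y: "y \<in> carrier M" "y \<ominus>\<^bsub>M\<^esub> x \<in> I"
    have "k \<odot>\<^bsub>M\<^esub> y \<ominus>\<^bsub>M\<^esub> k \<odot>\<^bsub>M\<^esub> x = k \<odot>\<^bsub>M\<^esub> (y \<ominus>\<^bsub>M\<^esub> x)"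
      using that y by (simp add: a_minus_def smult_r_distr smult_r_minus)
    then show "I +>\<^bsub>M\<^esub> (k \<odot>\<^bsub>M\<^esub> y) = I +>\<^bsub>M\<^esub> (k \<odot>\<^bsub>M\<^esub> x)"
      using that y submoduleE(4)[OF I that(1) y(2)] by (simp add: coset_eq_iff[OF I])
  qed
  then show ?thesis
    using I.a_subset by (auto simp: linear_maps_def quot_space_def I.a_rcos_sum intro: a_rcosetsI)
qed

lemma span_submodule:
  assumes "S \<subseteq> carrier M"
  shows "submodule (span R M S) R M"
proof (rule submoduleI)
  show "span R M S \<subseteq> carrier M"
    using carrier_is_submodule assms by (auto simp: span_def)
  show "\<zero>\<^bsub>M\<^esub> \<in> span R M S"
    by (auto simp: span_def dest: submodule.axioms(1) subgroup.one_closed[of _ "add_monoid M", simplified])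
qed (auto simp: span_def submoduleE)

lemma span_minimal: "submodule H R M \<Longrightarrow> S \<subseteq> H \<Longrightarrow> span R M S \<subseteq> H"
  by (auto simp: span_def)

lemma span_superset: "S \<subseteq> span R M S"
  by (auto simp: span_def)

end

section \<open>Algebras with a bilinear product\<close>

text \<open>The free nonassociative algebra satisfies all axioms of a Leibniz algebra except the Leibniz
  identity. This common part suffices for quotients by ideals and for induced maps.\<close>

locale bilinear_algebra = K?: field K + L?: module K L
  for K (structure) and L :: "('k, 'a, 'm) leibniz_scheme" (structure) +
  assumes bracket_closed:
      "\<lbrakk>x \<in> carrier L; y \<in> carrier L\<rbrakk> \<Longrightarrow> \<langle>x, y\<rangle>\<^bsub>L\<^esub> \<in> carrier L"
    and bracket_add_left:
      "\<lbrakk>x \<in> carrier L; y \<in> carrier L; z \<in> carrier L\<rbrakk> \<Longrightarrow>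
        \<langle>x \<oplus>\<^bsub>L\<^esub> y, z\<rangle>\<^bsub>L\<^esub> = \<langle>x, z\<rangle>\<^bsub>L\<^esub> \<oplus>\<^bsub>L\<^esub> \<langle>y, z\<rangle>\<^bsub>L\<^esub>"
    and bracket_add_right:
      "\<lbrakk>x \<in> carrier L; y \<in> carrier L; z \<in> carrier L\<rbrakk> \<Longrightarrow>
        \<langle>x, y \<oplus>\<^bsub>L\<^esub> z\<rangle>\<^bsub>L\<^esub> = \<langle>x, y\<rangle>\<^bsub>L\<^esub> \<oplus>\<^bsub>L\<^esub> \<langle>x, z\<rangle>\<^bsub>L\<^esub>"
    and bracket_smult_left:
      "\<lbrakk>k \<in> carrier K; x \<in> carrier L; y \<in> carrier L\<rbrakk> \<Longrightarrow>
        \<langle>k \<odot>\<^bsub>L\<^esub> x, y\<rangle>\<^bsub>L\<^esub> = k \<odot>\<^bsub>L\<^esub> \<langle>x, y\<rangle>\<^bsub>L\<^esub>"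
    and bracket_smult_right:
      "\<lbrakk>k \<in> carrier K; x \<in> carrier L; y \<in> carrier L\<rbrakk> \<Longrightarrow>
        \<langle>x, k \<odot>\<^bsub>L\<^esub> y\<rangle>\<^bsub>L\<^esub> = k \<odot>\<^bsub>L\<^esub> \<langle>x, y\<rangle>\<^bsub>L\<^esub>"

sublocale leibniz_algebra \<subseteq> bilinear_algebra
  by unfold_locales (fact bracket_closed bracket_add_left bracket_add_right
      bracket_smult_left bracket_smult_right)+

lemma
  assumes "h \<in> leibniz_hom K L M"
  shows leibniz_hom_linear: "h \<in> linear_maps K L M"
    and leibniz_hom_bracket: "x \<in> carrier L \<Longrightarrow> y \<in> carrier L \<Longrightarrow> h \<langle>x, y\<rangle>\<^bsub>L\<^esub> = \<langle>h x, h y\<rangle>\<^bsub>M\<^esub>"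
  using assms by (auto simp: leibniz_hom_def)

lemma bilinear_algebra_image:
  assumes "bilinear_algebra K L" and h: "h \<in> leibniz_hom K L M"
    and surj: "h ` carrier L = carrier M" and zero: "h \<zero>\<^bsub>L\<^esub> = \<zero>\<^bsub>M\<^esub>"
  shows "bilinear_algebra K M"
proof -
  interpret L: bilinear_algebra K L by fact
  note lin = leibniz_hom_linear[OF h]
  interpret M: module K M
    by (rule module_image[OF L.L.module_axioms lin surj zero])
  note hom = linear_maps_add[OF lin, symmetric] linear_maps_smult[OF lin, symmetric]
    leibniz_hom_bracket[OF h, symmetric]
  have mem: "x \<in> carrier M \<longleftrightarrow> (\<exists>a\<in>carrier L. x = h a)" for x
    using surj by auto
  show ?thesis
    by unfold_locales
      (auto simp: mem hom L.bracket_closed L.bracket_add_left L.bracket_add_right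
        L.bracket_smult_left L.bracket_smult_right intro: L.bracket_closed)
qed

lemma leibniz_hom_comp:
  assumes "g \<in> leibniz_hom K L M" "h \<in> leibniz_hom K M N"
  shows "h \<circ> g \<in> leibniz_hom K L N"
  using assms by (auto simp: leibniz_hom_def linear_maps_def Pi_iff)

lemma leibniz_hom_inv_into:
  assumes "bilinear_algebra K L" and h: "h \<in> leibniz_hom K L M"
    and bij: "bij_betw h (carrier L) (carrier M)"
  shows "inv_into (carrier L) h \<in> leibniz_hom K M L"
proof -
  interpret L: bilinear_algebra K L by fact
  note lin = leibniz_hom_linear[OF h]
  note hom = linear_maps_add[OF lin, symmetric] linear_maps_smult[OF lin, symmetric]
    leibniz_hom_bracket[OF h, symmetric]
  let ?i = "inv_into (carrier L) h"
  have inv: "?i (h a) = a" if "a \<in> carrier L" for a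
    using that bij by (simp add: bij_betw_def)
  have mem: "x \<in> carrier M \<longleftrightarrow> (\<exists>a\<in>carrier L. x = h a)" for x
    using bij by (auto simp: bij_betw_def)
  show ?thesis
    by (auto simp: leibniz_hom_def linear_maps_def mem hom inv L.bracket_closed)
qed

context bilinear_algebra
begin

lemma bracket_minus_left:
  assumes "x \<in> carrier L" "y \<in> carrier L" "z \<in> carrier L"
  shows "\<langle>x \<ominus>\<^bsub>L\<^esub> y, z\<rangle>\<^bsub>L\<^esub> = \<langle>x, z\<rangle>\<^bsub>L\<^esub> \<ominus>\<^bsub>L\<^esub> \<langle>y, z\<rangle>\<^bsub>L\<^esub>"
  using linear_maps_minus[OF L.module_axioms L.module_axioms, of "\<lambda>x. \<langle>x, z\<rangle>\<^bsub>L\<^esub>" x y] assms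
  by (auto simp: linear_maps_def bracket_closed bracket_add_left bracket_smult_left)

lemma bracket_minus_right:
  assumes "x \<in> carrier L" "y \<in> carrier L" "z \<in> carrier L"
  shows "\<langle>z, x \<ominus>\<^bsub>L\<^esub> y\<rangle>\<^bsub>L\<^esub> = \<langle>z, x\<rangle>\<^bsub>L\<^esub> \<ominus>\<^bsub>L\<^esub> \<langle>z, y\<rangle>\<^bsub>L\<^esub>"
  using linear_maps_minus[OF L.module_axioms L.module_axioms, of "\<lambda>x. \<langle>z, x\<rangle>\<^bsub>L\<^esub>" x y] assms
  by (auto simp: linear_maps_def bracket_closed bracket_add_right bracket_smult_right)

lemma bracket_zero:
  assumes "x \<in> carrier L"
  shows "\<langle>\<zero>\<^bsub>L\<^esub>, x\<rangle>\<^bsub>L\<^esub> = \<zero>\<^bsub>L\<^esub>" "\<langle>x, \<zero>\<^bsub>L\<^esub>\<rangle>\<^bsub>L\<^esub> = \<zero>\<^bsub>L\<^esub>"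
  using bracket_smult_left[of "\<zero>\<^bsub>K\<^esub>" "\<zero>\<^bsub>L\<^esub>" x] bracket_smult_right[of "\<zero>\<^bsub>K\<^esub>" x "\<zero>\<^bsub>L\<^esub>"] assms
  by (simp_all add: bracket_closed)

lemma leibniz_quot_simps:
  "carrier (leibniz_quot L I) = (\<lambda>x. I +>\<^bsub>L\<^esub> x) ` carrier L"
  "\<zero>\<^bsub>leibniz_quot L I\<^esub> = I"
  "(\<oplus>\<^bsub>leibniz_quot L I\<^esub>) = (\<oplus>\<^bsub>quot_space L I\<^esub>)"
  "(\<odot>\<^bsub>leibniz_quot L I\<^esub>) = (\<odot>\<^bsub>quot_space L I\<^esub>)"
  "\<langle>A, B\<rangle>\<^bsub>leibniz_quot L I\<^esub> = (\<Union>x\<in>A. \<Union>y\<in>B. I +>\<^bsub>L\<^esub> \<langle>x, y\<rangle>\<^bsub>L\<^esub>)"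
  by (auto simp: leibniz_quot_def quot_space_def module.extend_def leibniz.fields_def
      A_RCOSETS_def')

context
  fixes I
  assumes I: "leibniz_ideal K L I"
begin

lemma ideal_submodule: "submodule I K L"
  using I by (simp add: leibniz_ideal_def)

lemma leibniz_quot_hom: "(\<lambda>x. I +>\<^bsub>L\<^esub> x) \<in> leibniz_hom K L (leibniz_quot L I)"
proof -
  note sub = ideal_submodule
  have ideal: "\<langle>x, i\<rangle>\<^bsub>L\<^esub> \<in> I" "\<langle>i, x\<rangle>\<^bsub>L\<^esub> \<in> I" if "x \<in> carrier L" "i \<in> I" for x i
    using I that by (auto simp: leibniz_ideal_def)
  have left: "I +>\<^bsub>L\<^esub> \<langle>x', y\<rangle>\<^bsub>L\<^esub> = I +>\<^bsub>L\<^esub> \<langle>x, y\<rangle>\<^bsub>L\<^esub>"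
    if "x \<in> carrier L" "y \<in> carrier L" "x' \<in> carrier L" "x' \<ominus>\<^bsub>L\<^esub> x \<in> I" for x x' y
    using that ideal(2)[of y "x' \<ominus>\<^bsub>L\<^esub> x"]
    by (simp add: coset_eq_iff[OF sub] bracket_closed bracket_minus_left)
  have right: "I +>\<^bsub>L\<^esub> \<langle>x, y'\<rangle>\<^bsub>L\<^esub> = I +>\<^bsub>L\<^esub> \<langle>x, y\<rangle>\<^bsub>L\<^esub>"
    if "x \<in> carrier L" "y \<in> carrier L" "y' \<in> carrier L" "y' \<ominus>\<^bsub>L\<^esub> y \<in> I" for x y y'
    using that ideal(1)[of x "y' \<ominus>\<^bsub>L\<^esub> y"]
    by (simp add: coset_eq_iff[OF sub] bracket_closed bracket_minus_right)
  have "(\<Union>x'\<in>I +>\<^bsub>L\<^esub> x. \<Union>y'\<in>I +>\<^bsub>L\<^esub> y. I +>\<^bsub>L\<^esub> \<langle>x', y'\<rangle>\<^bsub>L\<^esub>) = I +>\<^bsub>L\<^esub> \<langle>x, y\<rangle>\<^bsub>L\<^esub>"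
    if x: "x \<in> carrier L" and y: "y \<in> carrier L" for x y
  proof -
    have inner: "(\<Union>y'\<in>I +>\<^bsub>L\<^esub> y. I +>\<^bsub>L\<^esub> \<langle>x', y'\<rangle>\<^bsub>L\<^esub>) = I +>\<^bsub>L\<^esub> \<langle>x', y\<rangle>\<^bsub>L\<^esub>"
      if "x' \<in> carrier L" for x'
      using that y right by (intro coset_saturated[OF sub y]) auto
    have "(\<Union>x'\<in>I +>\<^bsub>L\<^esub> x. \<Union>y'\<in>I +>\<^bsub>L\<^esub> y. I +>\<^bsub>L\<^esub> \<langle>x', y'\<rangle>\<^bsub>L\<^esub>)
        = (\<Union>y'\<in>I +>\<^bsub>L\<^esub> y. I +>\<^bsub>L\<^esub> \<langle>x, y'\<rangle>\<^bsub>L\<^esub>)"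
      using x y left by (intro coset_saturated[OF sub x]) (auto simp: inner)
    then show ?thesis using inner[OF x] by simp
  qed
  then show ?thesis
    using quot_space_linear[OF sub]
    by (auto simp: leibniz_hom_def linear_maps_def leibniz_quot_simps)
qed

lemma leibniz_quot_zero: "I +>\<^bsub>L\<^esub> \<zero>\<^bsub>L\<^esub> = \<zero>\<^bsub>leibniz_quot L I\<^esub>"
  using submoduleE(1)[OF ideal_submodule] by (simp add: leibniz_quot_simps)

lemma leibniz_quot_bilinear: "bilinear_algebra K (leibniz_quot L I)"
  by (rule bilinear_algebra_image[OF bilinear_algebra_axioms leibniz_quot_hom])
    (simp_all add: leibniz_quot_simps(1) leibniz_quot_zero)

text \<open>The algebra itself may violate the Leibniz identity as long as the ideal absorbs the
  violations. This covers both the free Leibniz algebra, a quotient of an algebra that is not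
  Leibniz, and quotients of Leibniz algebras.\<close>

lemma leibniz_quot_leibniz:
  assumes defect: "\<And>x y z. x \<in> carrier L \<Longrightarrow> y \<in> carrier L \<Longrightarrow> z \<in> carrier L \<Longrightarrow>
      \<langle>x, \<langle>y, z\<rangle>\<^bsub>L\<^esub>\<rangle>\<^bsub>L\<^esub> \<ominus>\<^bsub>L\<^esub> (\<langle>\<langle>x, y\<rangle>\<^bsub>L\<^esub>, z\<rangle>\<^bsub>L\<^esub> \<ominus>\<^bsub>L\<^esub> \<langle>\<langle>x, z\<rangle>\<^bsub>L\<^esub>, y\<rangle>\<^bsub>L\<^esub>) \<in> I"
  shows "leibniz_algebra K (leibniz_quot L I)"
proof -
  let ?q = "leibniz_quot L I"
  interpret q: bilinear_algebra K ?q by (rule leibniz_quot_bilinear)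
  note hom = leibniz_hom_bracket[OF leibniz_quot_hom, symmetric]
    linear_maps_minus[OF L.module_axioms q.L.module_axioms leibniz_hom_linear[OF leibniz_quot_hom],
      symmetric]
  have "\<langle>A, \<langle>B, C\<rangle>\<^bsub>?q\<^esub>\<rangle>\<^bsub>?q\<^esub> = \<langle>\<langle>A, B\<rangle>\<^bsub>?q\<^esub>, C\<rangle>\<^bsub>?q\<^esub> \<ominus>\<^bsub>?q\<^esub> \<langle>\<langle>A, C\<rangle>\<^bsub>?q\<^esub>, B\<rangle>\<^bsub>?q\<^esub>"
    if ABC: "A \<in> carrier ?q" "B \<in> carrier ?q" "C \<in> carrier ?q" for A B C
  proof -
    obtain x y z where xyz: "x \<in> carrier L" "y \<in> carrier L" "z \<in> carrier L"
      and "A = I +>\<^bsub>L\<^esub> x" "B = I +>\<^bsub>L\<^esub> y" "C = I +>\<^bsub>L\<^esub> z"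
      using ABC by (auto simp: leibniz_quot_simps)
    then show ?thesis
      using defect[OF xyz] by (simp add: hom bracket_closed coset_eq_iff[OF ideal_submodule])
  qed
  then show ?thesis by unfold_locales (auto intro: q.bracket_closed simp: q.bracket_add_left
    q.bracket_add_right q.bracket_smult_left q.bracket_smult_right)
qed

lemma leibniz_quot_factor:
  assumes "bilinear_algebra K M" and h: "h \<in> leibniz_hom K L M"
    and vanish: "\<And>x. x \<in> I \<Longrightarrow> h x = \<zero>\<^bsub>M\<^esub>"
  obtains g where "g \<in> leibniz_hom K (leibniz_quot L I) M"
    "\<And>x. x \<in> carrier L \<Longrightarrow> g (I +>\<^bsub>L\<^esub> x) = h x"
proof -
  interpret M: bilinear_algebra K M by fact
  note lin = leibniz_hom_linear[OF h]
  define g where "g A = h (SOME x. x \<in> carrier L \<and> I +>\<^bsub>L\<^esub> x = A)" for A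
  have g: "g (I +>\<^bsub>L\<^esub> x) = h x" if x: "x \<in> carrier L" for x
  proof -
    define y where "y = (SOME y. y \<in> carrier L \<and> I +>\<^bsub>L\<^esub> y = I +>\<^bsub>L\<^esub> x)"
    have y: "y \<in> carrier L" "I +>\<^bsub>L\<^esub> y = I +>\<^bsub>L\<^esub> x"
      using someI[of "\<lambda>y. y \<in> carrier L \<and> I +>\<^bsub>L\<^esub> y = I +>\<^bsub>L\<^esub> x" x] x by (auto simp: y_def)
    then have "h (y \<ominus>\<^bsub>L\<^esub> x) = \<zero>\<^bsub>M\<^esub>"
      using coset_eq_iff[OF ideal_submodule] x vanish by blast
    then have "h y = h x"
      using linear_maps_minus[OF L.module_axioms M.L.module_axioms lin y(1) x]
        linear_maps_closed[OF lin] x y(1) by (simp add: M.L.M.minus_eq_zero_iff)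
    then show ?thesis by (simp add: g_def y_def)
  qed
  note q = leibniz_hom_bracket[OF leibniz_quot_hom, symmetric]
    linear_maps_add[OF leibniz_hom_linear[OF leibniz_quot_hom], symmetric]
    linear_maps_smult[OF leibniz_hom_linear[OF leibniz_quot_hom], symmetric]
  have "g \<in> leibniz_hom K (leibniz_quot L I) M"
    by (auto simp: leibniz_hom_def linear_maps_def leibniz_quot_simps(1) q g bracket_closed
        linear_maps_closed[OF lin] linear_maps_add[OF lin] linear_maps_smult[OF lin]
        leibniz_hom_bracket[OF h])
  with g show thesis using that by blast
qed

end

end

section \<open>Linear maps out of a free space\<close>

lemma free_space_simps:
  "c \<in> carrier (free_space K B) \<longleftrightarrow> (\<forall>b. c b \<in> carrier K) \<and> (\<forall>b. b \<notin> B \<longrightarrow> c b = \<zero>\<^bsub>K\<^esub>) \<and>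
     finite {b. c b \<noteq> \<zero>\<^bsub>K\<^esub>}"
  "\<zero>\<^bsub>free_space K B\<^esub> = (\<lambda>b. \<zero>\<^bsub>K\<^esub>)"
  "c \<oplus>\<^bsub>free_space K B\<^esub> d = (\<lambda>b. c b \<oplus>\<^bsub>K\<^esub> d b)"
  "k \<odot>\<^bsub>free_space K B\<^esub> c = (\<lambda>b. k \<otimes>\<^bsub>K\<^esub> c b)"
  by (simp_all add: free_space_def)

context field
begin

lemma free_space_add_closed:
  assumes "c \<in> carrier (free_space R B)" "d \<in> carrier (free_space R B)"
  shows "(\<lambda>b. c b \<oplus> d b) \<in> carrier (free_space R B)"
proof -
  have "{b. c b \<oplus> d b \<noteq> \<zero>} \<subseteq> {b. c b \<noteq> \<zero>} \<union> {b. d b \<noteq> \<zero>}"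
    by auto
  then show ?thesis
    using assms by (auto simp: free_space_simps intro: finite_subset)
qed

lemma free_space_smult_closed:
  assumes "k \<in> carrier R" "c \<in> carrier (free_space R B)"
  shows "(\<lambda>b. k \<otimes> c b) \<in> carrier (free_space R B)"
proof -
  have "{b. k \<otimes> c b \<noteq> \<zero>} \<subseteq> {b. c b \<noteq> \<zero>}"
    using assms by auto
  then show ?thesis
    using assms by (auto simp: free_space_simps intro: finite_subset)
qed

lemma free_space_module: "module R (free_space R B)"
proof -
  let ?V = "free_space R B"
  note coeff = free_space_simps(1)[THEN iffD1, THEN conjunct1, rule_format]
  have "abelian_group ?V"
  proof (rule abelian_groupI)
    show "c \<oplus>\<^bsub>?V\<^esub> d \<in> carrier ?V" if "c \<in> carrier ?V" "d \<in> carrier ?V" for c d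
      using free_space_add_closed[OF that] by (simp add: free_space_simps(3))
    show "\<zero>\<^bsub>?V\<^esub> \<in> carrier ?V"
      by (simp add: free_space_simps)
    fix c assume c: "c \<in> carrier ?V"
    show "\<zero>\<^bsub>?V\<^esub> \<oplus>\<^bsub>?V\<^esub> c = c"
      using coeff[OF c] by (simp add: free_space_simps(2,3))
    have "(\<lambda>b. \<ominus> \<one> \<otimes> c b) \<oplus>\<^bsub>?V\<^esub> c = \<zero>\<^bsub>?V\<^esub>"
      using coeff[OF c] by (simp add: free_space_simps(2,3) l_minus l_neg)
    moreover have "(\<lambda>b. \<ominus> \<one> \<otimes> c b) \<in> carrier ?V"
      by (rule free_space_smult_closed[OF _ c]) simp
    ultimately show "\<exists>d\<in>carrier ?V. d \<oplus>\<^bsub>?V\<^esub> c = \<zero>\<^bsub>?V\<^esub>"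
      by (rule bexI)
    fix d assume d: "d \<in> carrier ?V"
    show "c \<oplus>\<^bsub>?V\<^esub> d = d \<oplus>\<^bsub>?V\<^esub> c"
      using coeff[OF c] coeff[OF d] by (simp add: free_space_simps(3) a_comm)
    fix e assume e: "e \<in> carrier ?V"
    show "c \<oplus>\<^bsub>?V\<^esub> d \<oplus>\<^bsub>?V\<^esub> e = c \<oplus>\<^bsub>?V\<^esub> (d \<oplus>\<^bsub>?V\<^esub> e)"
      using coeff[OF c] coeff[OF d] coeff[OF e] by (simp add: free_space_simps(3) a_assoc)
  qed
  then show ?thesis
  proof (intro moduleI is_cring)
    show "\<one> \<odot>\<^bsub>?V\<^esub> c = c" if "c \<in> carrier ?V" for c
      using coeff[OF that] by (simp add: free_space_simps(4))
    fix k c assume k: "k \<in> carrier R" and c: "c \<in> carrier ?V"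
    show "k \<odot>\<^bsub>?V\<^esub> c \<in> carrier ?V"
      using free_space_smult_closed[OF k c] by (simp add: free_space_simps(4))
    show "(k \<oplus> l) \<odot>\<^bsub>?V\<^esub> c = k \<odot>\<^bsub>?V\<^esub> c \<oplus>\<^bsub>?V\<^esub> l \<odot>\<^bsub>?V\<^esub> c"
      "(k \<otimes> l) \<odot>\<^bsub>?V\<^esub> c = k \<odot>\<^bsub>?V\<^esub> (l \<odot>\<^bsub>?V\<^esub> c)" if "l \<in> carrier R" for l
      using coeff[OF c] k that by (simp_all add: free_space_simps(3,4) l_distr m_assoc)
    show "k \<odot>\<^bsub>?V\<^esub> (c \<oplus>\<^bsub>?V\<^esub> d) = k \<odot>\<^bsub>?V\<^esub> c \<oplus>\<^bsub>?V\<^esub> k \<odot>\<^bsub>?V\<^esub> d"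
      if "d \<in> carrier ?V" for d
      using coeff[OF c] coeff[OF that] k by (simp add: free_space_simps(3,4) r_distr)
  qed
qed

lemma basis_vec_closed: "b \<in> B \<Longrightarrow> basis_vec R b \<in> carrier (free_space R B)"
  by (auto simp: free_space_simps basis_vec_def)

lemma pure_tensor_closed:
  assumes "x \<in> carrier M" "y \<in> carrier N"
  shows "pure_tensor R M N x y \<in> carrier (tensor_space R M N)"
  using basis_vec_closed[of "(x, y)" "carrier M \<times> carrier N"] assms
  by (auto simp: pure_tensor_def tensor_space_def quot_space_def A_RCOSETS_def')

lemma free_space_generated:
  assumes H: "submodule H R (free_space R B)" and basis: "\<And>b. b \<in> B \<Longrightarrow> basis_vec R b \<in> H"
  shows "carrier (free_space R B) \<subseteq> H"
proof -
  let ?V = "free_space R B"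
  interpret V: module R ?V by (rule free_space_module)
  note H_closed = V.submoduleE[OF H]
  have "c \<in> H" if "finite A" "c \<in> carrier ?V" "{b. c b \<noteq> \<zero>} = A" for A c
    using that
  proof (induction A arbitrary: c)
    case empty
    then have "c = \<zero>\<^bsub>?V\<^esub>" by (auto simp: free_space_simps)
    then show ?case
      using subgroup.one_closed[OF submodule.axioms(1)[OF H]] by simp
  next
    case (insert b A)
    let ?c = "c(b := \<zero>)"
    have c_supp: "c x \<noteq> \<zero> \<longleftrightarrow> x = b \<or> x \<in> A" for x
      using insert.prems(2) by blast
    have c_coeff: "c x \<in> carrier R" "x \<notin> B \<Longrightarrow> c x = \<zero>" for x
      using insert.prems(1) by (simp_all add: free_space_simps(1))
    have supp: "{x. ?c x \<noteq> \<zero>} = A"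
      using insert.hyps(2) c_supp by auto
    then have c: "?c \<in> carrier ?V"
      using insert.hyps(1) c_coeff by (simp add: free_space_simps(1))
    have b: "b \<in> B"
      using c_coeff(2) c_supp by blast
    have "?c \<oplus>\<^bsub>?V\<^esub> c b \<odot>\<^bsub>?V\<^esub> basis_vec R b \<in> H"
      using insert.IH[OF c supp] basis[OF b] c_coeff(1) by (intro H_closed(4,5))
    moreover have "?c \<oplus>\<^bsub>?V\<^esub> c b \<odot>\<^bsub>?V\<^esub> basis_vec R b = c"
      using c_coeff(1) by (auto simp: free_space_simps(3,4) basis_vec_def)
    ultimately show ?case by simp
  qed
  then show ?thesis by (auto simp: free_space_simps)
qed

lemma free_space_linear_eqI:
  assumes "module R N" and h: "h \<in> linear_maps R (free_space R B) N"
    and g: "g \<in> linear_maps R (free_space R B) N"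
    and basis: "\<And>b. b \<in> B \<Longrightarrow> h (basis_vec R b) = g (basis_vec R b)"
    and c: "c \<in> carrier (free_space R B)"
  shows "h c = g c"
proof -
  let ?V = "free_space R B"
  interpret V: module R ?V by (rule free_space_module)
  interpret N: module R N by fact
  note closed = linear_maps_closed[OF h] linear_maps_closed[OF g]
  let ?d = "\<lambda>c. h c \<ominus>\<^bsub>N\<^esub> g c"
  have "?d \<in> linear_maps R ?V N"
    unfolding linear_maps_def
  proof (intro CollectI conjI ballI)
    show "?d \<in> carrier ?V \<rightarrow> carrier N" using closed by simp
    fix c assume c: "c \<in> carrier ?V"
    show "?d (c \<oplus>\<^bsub>?V\<^esub> d) = ?d c \<oplus>\<^bsub>N\<^esub> ?d d" if "d \<in> carrier ?V" for d
      using c that closed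
      by (simp add: linear_maps_add[OF h] linear_maps_add[OF g] N.M.add_diff_add)
  next
    fix k c assume "k \<in> carrier R" "c \<in> carrier ?V"
    then show "?d (k \<odot>\<^bsub>?V\<^esub> c) = k \<odot>\<^bsub>N\<^esub> ?d c"
      using closed
      by (simp add: linear_maps_smult[OF h] linear_maps_smult[OF g] a_minus_def N.smult_r_distr
        N.smult_r_minus)
  qed
  then have "submodule {c \<in> carrier ?V. ?d c = \<zero>\<^bsub>N\<^esub>} R ?V"
    by (rule linear_maps_kernel_submodule[OF V.module_axioms N.module_axioms])
  then have "carrier ?V \<subseteq> {c \<in> carrier ?V. ?d c = \<zero>\<^bsub>N\<^esub>}"
    by (rule free_space_generated) (simp add: basis basis_vec_closed closed N.M.minus_eq_zero_iff)
  then have "?d c = \<zero>\<^bsub>N\<^esub>"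
    using c by blast
  then show ?thesis
    using N.M.minus_eq_zero_iff closed[OF c] by simp
qed

text \<open>The extension is the finite sum over the support. Sums over different supports are compared
  over a common finite superset, on which the additional coefficients vanish.\<close>

lemma free_space_linear_extension:
  assumes "module R N" and v: "\<And>b. b \<in> B \<Longrightarrow> v b \<in> carrier N"
  obtains h where "h \<in> linear_maps R (free_space R B) N"
    "\<And>b. b \<in> B \<Longrightarrow> h (basis_vec R b) = v b"
proof -
  interpret V: module R "free_space R B" by (rule free_space_module)
  interpret N: module R N by fact
  define h where "h c = (\<Oplus>\<^bsub>N\<^esub>b\<in>{b. c b \<noteq> \<zero>}. c b \<odot>\<^bsub>N\<^esub> v b)" for c
  have supp: "finite {b. c b \<noteq> \<zero>}" "{b. c b \<noteq> \<zero>} \<subseteq> B" "\<And>b. c b \<in> carrier R"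
    if "c \<in> carrier (free_space R B)" for c
    using that by (auto simp: free_space_simps)
  have h_eq: "h c = (\<Oplus>\<^bsub>N\<^esub>b\<in>A. c b \<odot>\<^bsub>N\<^esub> v b)"
    if c: "c \<in> carrier (free_space R B)" and A: "finite A" "{b. c b \<noteq> \<zero>} \<subseteq> A" "A \<subseteq> B" for c A
    unfolding h_def using A supp(3)[OF c] v
    by (intro N.M.add.finprod_mono_neutral_cong_left) auto
  have "h \<in> linear_maps R (free_space R B) N"
    unfolding linear_maps_def
  proof (intro CollectI conjI ballI)
    show "h \<in> carrier (free_space R B) \<rightarrow> carrier N"
    proof
      fix c assume c: "c \<in> carrier (free_space R B)"
      have "v b \<in> carrier N" if "c b \<noteq> \<zero>" for b
        using that supp(2)[OF c] v by blast
      then show "h c \<in> carrier N"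
        using supp(3)[OF c] by (auto simp: h_def intro!: N.M.finsum_closed)
    qed
  next
    fix c d assume c: "c \<in> carrier (free_space R B)" and d: "d \<in> carrier (free_space R B)"
    let ?A = "{b. c b \<noteq> \<zero>} \<union> {b. d b \<noteq> \<zero>}"
    have A: "finite ?A" "?A \<subseteq> B" using supp c d by auto
    have vA: "\<And>b. b \<in> ?A \<Longrightarrow> v b \<in> carrier N" using A v by blast
    have "h (c \<oplus>\<^bsub>free_space R B\<^esub> d) = (\<Oplus>\<^bsub>N\<^esub>b\<in>?A. (c b \<oplus> d b) \<odot>\<^bsub>N\<^esub> v b)"
      using A supp(3)[OF c] supp(3)[OF d] free_space_add_closed[OF c d]
      by (subst h_eq[where A = ?A]) (auto simp: free_space_simps(3))
    also have "\<dots> = (\<Oplus>\<^bsub>N\<^esub>b\<in>?A. c b \<odot>\<^bsub>N\<^esub> v b \<oplus>\<^bsub>N\<^esub> d b \<odot>\<^bsub>N\<^esub> v b)"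
      using vA supp(3)[OF c] supp(3)[OF d]
      by (intro N.M.finsum_cong') (auto simp: N.smult_l_distr)
    also have "\<dots> = h c \<oplus>\<^bsub>N\<^esub> h d"
      using A supp(3)[OF c] supp(3)[OF d] vA
      by (subst N.M.finsum_addf) (auto simp: h_eq[OF c, of ?A] h_eq[OF d, of ?A])
    finally show "h (c \<oplus>\<^bsub>free_space R B\<^esub> d) = h c \<oplus>\<^bsub>N\<^esub> h d" .
  next
    fix k c assume k: "k \<in> carrier R" and c: "c \<in> carrier (free_space R B)"
    let ?A = "{b. c b \<noteq> \<zero>}"
    have vA: "\<And>b. b \<in> ?A \<Longrightarrow> v b \<in> carrier N" using supp(2)[OF c] v by blast
    have "h (k \<odot>\<^bsub>free_space R B\<^esub> c) = (\<Oplus>\<^bsub>N\<^esub>b\<in>?A. (k \<otimes> c b) \<odot>\<^bsub>N\<^esub> v b)"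
      using supp[OF c] k free_space_smult_closed[OF k c]
      by (subst h_eq[where A = ?A]) (auto simp: free_space_simps(4))
    also have "\<dots> = (\<Oplus>\<^bsub>N\<^esub>b\<in>?A. k \<odot>\<^bsub>N\<^esub> (c b \<odot>\<^bsub>N\<^esub> v b))"
      using vA supp[OF c] k by (intro N.M.finsum_cong') (auto simp: N.smult_assoc1)
    also have "\<dots> = k \<odot>\<^bsub>N\<^esub> h c"
      using vA supp[OF c] k by (simp add: h_def N.finsum_smult_ldistr Pi_iff)
    finally show "h (k \<odot>\<^bsub>free_space R B\<^esub> c) = k \<odot>\<^bsub>N\<^esub> h c" .
  qed
  moreover have "h (basis_vec R b) = v b" if "b \<in> B" for b
    using v[OF that] h_eq[OF basis_vec_closed[OF that], of "{b}"] that
    by (simp add: basis_vec_def)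
  ultimately show thesis using that by blast
qed

end

section \<open>The universal property of the free Leibniz algebra\<close>

lemma nonassoc_algebra_simps:
  "carrier (nonassoc_algebra K X) = carrier (free_space K {m. gens m \<subseteq> X})"
  "\<zero>\<^bsub>nonassoc_algebra K X\<^esub> = \<zero>\<^bsub>free_space K {m. gens m \<subseteq> X}\<^esub>"
  "(\<oplus>\<^bsub>nonassoc_algebra K X\<^esub>) = (\<oplus>\<^bsub>free_space K {m. gens m \<subseteq> X}\<^esub>)"
  "(\<odot>\<^bsub>nonassoc_algebra K X\<^esub>) = (\<odot>\<^bsub>free_space K {m. gens m \<subseteq> X}\<^esub>)"
  "\<langle>c, d\<rangle>\<^bsub>nonassoc_algebra K X\<^esub> = (\<lambda>m. case m of Gen x \<Rightarrow> \<zero>\<^bsub>K\<^esub> | Prod a b \<Rightarrow> c a \<otimes>\<^bsub>K\<^esub> d b)"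
  by (simp_all add: nonassoc_algebra_def free_space_def module.extend_def leibniz.fields_def)

lemma linear_maps_nonassoc_algebra:
  "linear_maps K (nonassoc_algebra K X) M = linear_maps K (free_space K {m. gens m \<subseteq> X}) M"
  by (simp add: linear_maps_def nonassoc_algebra_simps)

context field
begin

lemma nonassoc_algebra_bilinear: "bilinear_algebra R (nonassoc_algebra R X)"
proof -
  let ?B = "{m. gens m \<subseteq> X}"
  let ?A = "nonassoc_algebra R X"
  interpret V: module R "free_space R ?B" by (rule free_space_module)
  interpret A: module R ?A
    by (rule module_image[OF V.module_axioms, of id])
      (auto simp: linear_maps_def nonassoc_algebra_simps)
  have "\<langle>c, d\<rangle>\<^bsub>?A\<^esub> \<in> carrier ?A" if c: "c \<in> carrier ?A" and d: "d \<in> carrier ?A" for c d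
  proof -
    have c': "\<And>m. c m \<in> carrier R" "\<And>m. \<not> gens m \<subseteq> X \<Longrightarrow> c m = \<zero>" "finite {m. c m \<noteq> \<zero>}"
      and d': "\<And>m. d m \<in> carrier R" "\<And>m. \<not> gens m \<subseteq> X \<Longrightarrow> d m = \<zero>" "finite {m. d m \<noteq> \<zero>}"
      using c d by (simp_all add: nonassoc_algebra_simps(1) free_space_simps(1))
    have "{m. \<langle>c, d\<rangle>\<^bsub>?A\<^esub> m \<noteq> \<zero>} \<subseteq> (\<lambda>(a, b). Prod a b) ` ({a. c a \<noteq> \<zero>} \<times> {b. d b \<noteq> \<zero>})"
    proof
      fix m assume m: "m \<in> {m. \<langle>c, d\<rangle>\<^bsub>?A\<^esub> m \<noteq> \<zero>}"
      then obtain a b where ab: "m = Prod a b"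
        by (cases m) (simp_all add: nonassoc_algebra_simps(5))
      with m have "c a \<otimes> d b \<noteq> \<zero>"
        by (simp add: nonassoc_algebra_simps(5))
      then have "c a \<noteq> \<zero>" "d b \<noteq> \<zero>"
        using c'(1) d'(1) by auto
      with ab show "m \<in> (\<lambda>(a, b). Prod a b) ` ({a. c a \<noteq> \<zero>} \<times> {b. d b \<noteq> \<zero>})"
        by force
    qed
    then have "finite {m. \<langle>c, d\<rangle>\<^bsub>?A\<^esub> m \<noteq> \<zero>}"
      by (rule finite_subset) (use c'(3) d'(3) in simp)
    moreover have "\<langle>c, d\<rangle>\<^bsub>?A\<^esub> m \<in> carrier R" for m
      using c'(1) d'(1) by (cases m) (simp_all add: nonassoc_algebra_simps(5))
    moreover have "\<langle>c, d\<rangle>\<^bsub>?A\<^esub> m = \<zero>" if "\<not> gens m \<subseteq> X" for m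
    proof (cases m)
      case (Prod a b)
      then have "c a = \<zero> \<or> d b = \<zero>"
        using that c'(2) d'(2) by auto
      then show ?thesis
        using Prod c'(1) d'(1) by (auto simp: nonassoc_algebra_simps(5))
    qed (simp add: nonassoc_algebra_simps(5))
    ultimately show ?thesis
      by (simp add: nonassoc_algebra_simps(1) free_space_simps(1))
  qed
  then show ?thesis
    by unfold_locales
      (auto simp: nonassoc_algebra_simps free_space_simps l_distr r_distr m_ac fun_eq_iff
        split: magma.splits)
qed

lemma nonassoc_algebra_basis_bracket:
  "\<langle>basis_vec R a, basis_vec R b\<rangle>\<^bsub>nonassoc_algebra R X\<^esub> = basis_vec R (Prod a b)"
  by (auto simp: nonassoc_algebra_simps basis_vec_def fun_eq_iff split: magma.splits)

end

primrec magma_eval :: "('k, 'a, 'm) leibniz_scheme \<Rightarrow> ('x \<Rightarrow> 'a) \<Rightarrow> 'x magma \<Rightarrow> 'a"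
  where
    "magma_eval M g (Gen x) = g x"
  | "magma_eval M g (Prod a b) = \<langle>magma_eval M g a, magma_eval M g b\<rangle>\<^bsub>M\<^esub>"

text \<open>The linear extension of the evaluation of monomials respects products: with one argument
  fixed, both sides of the product rule are linear in the other, so that it can be checked on
  basis vectors, first in the left and then in the right argument.\<close>

lemma (in bilinear_algebra) nonassoc_algebra_extension:
  assumes g: "\<And>x. x \<in> X \<Longrightarrow> g x \<in> carrier L"
  obtains h where "h \<in> leibniz_hom K (nonassoc_algebra K X) L"
    "\<And>x. x \<in> X \<Longrightarrow> h (basis_vec K (Gen x)) = g x"
proof -
  let ?B = "{m. gens m \<subseteq> X}"
  let ?A = "nonassoc_algebra K X"
  interpret A: bilinear_algebra K ?A by (rule nonassoc_algebra_bilinear)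
  have ev: "magma_eval L g m \<in> carrier L" if "m \<in> ?B" for m
    using that by (induction m) (auto simp: g bracket_closed)
  obtain h where h: "h \<in> linear_maps K (free_space K ?B) L"
    and h_basis: "\<And>m. m \<in> ?B \<Longrightarrow> h (basis_vec K m) = magma_eval L g m"
    using free_space_linear_extension[OF L.module_axioms, of ?B "magma_eval L g"] ev by auto
  have hA: "h \<in> linear_maps K ?A L" using h by (simp add: linear_maps_nonassoc_algebra)
  note h_simps = linear_maps_closed[OF hA] linear_maps_add[OF hA] linear_maps_smult[OF hA]
  note basis_closed = basis_vec_closed[of _ ?B, folded nonassoc_algebra_simps(1)[of K X]]
  note A_simps = A.bracket_closed A.bracket_add_left A.bracket_add_right
    A.bracket_smult_left A.bracket_smult_right
    bracket_closed bracket_add_left bracket_add_right bracket_smult_left bracket_smult_right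
  have eqI: "h1 c = h2 c" if "h1 \<in> linear_maps K ?A L" "h2 \<in> linear_maps K ?A L"
    "\<And>m. m \<in> ?B \<Longrightarrow> h1 (basis_vec K m) = h2 (basis_vec K m)" "c \<in> carrier ?A" for h1 h2 c
    using free_space_linear_eqI[OF L.module_axioms, of h1 ?B h2 c] that
    by (simp add: linear_maps_nonassoc_algebra nonassoc_algebra_simps(1))
  have left: "h \<langle>c, basis_vec K b\<rangle>\<^bsub>?A\<^esub> = \<langle>h c, h (basis_vec K b)\<rangle>\<^bsub>L\<^esub>"
    if b: "b \<in> ?B" and c: "c \<in> carrier ?A" for b c
  proof (rule eqI[OF _ _ _ c])
    show "(\<lambda>c. h \<langle>c, basis_vec K b\<rangle>\<^bsub>?A\<^esub>) \<in> linear_maps K ?A L"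
      "(\<lambda>c. \<langle>h c, h (basis_vec K b)\<rangle>\<^bsub>L\<^esub>) \<in> linear_maps K ?A L"
      using basis_closed[OF b] by (auto simp: linear_maps_def h_simps A_simps)
    show "h \<langle>basis_vec K a, basis_vec K b\<rangle>\<^bsub>?A\<^esub> = \<langle>h (basis_vec K a), h (basis_vec K b)\<rangle>\<^bsub>L\<^esub>"
      if "a \<in> ?B" for a
      using that b by (simp add: nonassoc_algebra_basis_bracket h_basis)
  qed
  have "h \<langle>c, d\<rangle>\<^bsub>?A\<^esub> = \<langle>h c, h d\<rangle>\<^bsub>L\<^esub>" if c: "c \<in> carrier ?A" and d: "d \<in> carrier ?A" for c d
  proof (rule eqI[OF _ _ _ d])
    show "(\<lambda>d. h \<langle>c, d\<rangle>\<^bsub>?A\<^esub>) \<in> linear_maps K ?A L" "(\<lambda>d. \<langle>h c, h d\<rangle>\<^bsub>L\<^esub>) \<in> linear_maps K ?A L"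
      using c by (auto simp: linear_maps_def h_simps A_simps)
  qed (use left c in auto)
  then have "h \<in> leibniz_hom K ?A L"
    using hA by (simp add: leibniz_hom_def)
  moreover have "h (basis_vec K (Gen x)) = g x" if "x \<in> X" for x
    using h_basis[of "Gen x"] that by simp
  ultimately show thesis using that by blast
qed

lemma (in bilinear_algebra) nonassoc_algebra_hom_eqI:
  assumes h: "h \<in> leibniz_hom K (nonassoc_algebra K X) L"
    and h': "h' \<in> leibniz_hom K (nonassoc_algebra K X) L"
    and gen: "\<And>x. x \<in> X \<Longrightarrow> h (basis_vec K (Gen x)) = h' (basis_vec K (Gen x))"
    and c: "c \<in> carrier (nonassoc_algebra K X)"
  shows "h c = h' c"
proof -
  let ?B = "{m. gens m \<subseteq> X}"
  note basis_closed = basis_vec_closed[of _ ?B, folded nonassoc_algebra_simps(1)[of K X]]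
  have "h (basis_vec K m) = h' (basis_vec K m)" if "m \<in> ?B" for m
    using that
  proof (induction m)
    case (Prod a b)
    then show ?case
      using leibniz_hom_bracket[OF h, of "basis_vec K a" "basis_vec K b"]
        leibniz_hom_bracket[OF h', of "basis_vec K a" "basis_vec K b"] basis_closed
      by (simp add: nonassoc_algebra_basis_bracket)
  qed (simp add: gen)
  then show ?thesis
    using free_space_linear_eqI[OF L.module_axioms, of h ?B h' c] h h' c
    by (simp add: leibniz_hom_def linear_maps_nonassoc_algebra nonassoc_algebra_simps(1))
qed

context field
begin

abbreviation "leibniz_defect A x y z \<equiv>
  \<langle>x, \<langle>y, z\<rangle>\<^bsub>A\<^esub>\<rangle>\<^bsub>A\<^esub> \<ominus>\<^bsub>A\<^esub> (\<langle>\<langle>x, y\<rangle>\<^bsub>A\<^esub>, z\<rangle>\<^bsub>A\<^esub> \<ominus>\<^bsub>A\<^esub> \<langle>\<langle>x, z\<rangle>\<^bsub>A\<^esub>, y\<rangle>\<^bsub>A\<^esub>)"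

lemma free_leibniz_ideal_ideal: "leibniz_ideal R (nonassoc_algebra R X) (free_leibniz_ideal R X)"
  and free_leibniz_ideal_defect: "\<lbrakk>x \<in> carrier (nonassoc_algebra R X);
    y \<in> carrier (nonassoc_algebra R X); z \<in> carrier (nonassoc_algebra R X)\<rbrakk> \<Longrightarrow>
    leibniz_defect (nonassoc_algebra R X) x y z \<in> free_leibniz_ideal R X"
proof -
  let ?A = "nonassoc_algebra R X"
  interpret A: bilinear_algebra R ?A by (rule nonassoc_algebra_bilinear)
  define \<I> where "\<I> = {I. leibniz_ideal R ?A I \<and>
    (\<forall>x\<in>carrier ?A. \<forall>y\<in>carrier ?A. \<forall>z\<in>carrier ?A. leibniz_defect ?A x y z \<in> I)}"
  have eq: "free_leibniz_ideal R X = \<Inter>\<I>"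
    by (simp add: free_leibniz_ideal_def \<I>_def Let_def)
  have whole: "carrier ?A \<in> \<I>"
    by (auto simp: \<I>_def leibniz_ideal_def A.bracket_closed A.L.carrier_is_submodule)
  have sub: "submodule I R ?A" if "I \<in> \<I>" for I
    using that by (simp add: \<I>_def leibniz_ideal_def)
  have "submodule (\<Inter>\<I>) R ?A"
  proof (rule A.L.submoduleI)
    show "\<zero>\<^bsub>?A\<^esub> \<in> \<Inter>\<I>"
      using subgroup.one_closed[OF submodule.axioms(1)[OF sub]] by auto
  qed (use whole A.L.submoduleE[OF sub] in auto)
  then show "leibniz_ideal R ?A (free_leibniz_ideal R X)"
    by (auto simp: leibniz_ideal_def eq \<I>_def)
  show "leibniz_defect ?A x y z \<in> free_leibniz_ideal R X"
    if "x \<in> carrier ?A" "y \<in> carrier ?A" "z \<in> carrier ?A"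
    using that by (auto simp: eq \<I>_def)
qed

lemma free_leibniz_algebra: "leibniz_algebra R (free_leibniz R X)"
proof -
  interpret A: bilinear_algebra R "nonassoc_algebra R X" by (rule nonassoc_algebra_bilinear)
  show ?thesis
    unfolding free_leibniz_def
    by (intro A.leibniz_quot_leibniz free_leibniz_ideal_ideal free_leibniz_ideal_defect)
qed

end

context leibniz_algebra
begin

text \<open>The kernel of a map into a Leibniz algebra is an ideal that contains all defects of the
  Leibniz identity, hence one of the ideals whose intersection is the ideal in question.\<close>

lemma free_leibniz_ideal_vanish:
  assumes h: "h \<in> leibniz_hom K (nonassoc_algebra K X) L" and c: "c \<in> free_leibniz_ideal K X"
  shows "h c = \<zero>\<^bsub>L\<^esub>"
proof -
  let ?A = "nonassoc_algebra K X"
  interpret A: bilinear_algebra K ?A by (rule nonassoc_algebra_bilinear)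
  note lin = leibniz_hom_linear[OF h]
  note minus = linear_maps_minus[OF A.L.module_axioms L.module_axioms lin]
  let ?I = "{x \<in> carrier ?A. h x = \<zero>\<^bsub>L\<^esub>}"
  have "leibniz_ideal K ?A ?I"
    using linear_maps_kernel_submodule[OF A.L.module_axioms L.module_axioms lin]
    by (auto simp: leibniz_ideal_def A.bracket_closed leibniz_hom_bracket[OF h] bracket_zero
        linear_maps_closed[OF lin])
  moreover have "leibniz_defect ?A x y z \<in> ?I"
    if "x \<in> carrier ?A" "y \<in> carrier ?A" "z \<in> carrier ?A" for x y z
    using that linear_maps_closed[OF lin]
    by (simp add: minus A.bracket_closed leibniz_hom_bracket[OF h] leibniz_identity bracket_closed
      L.M.minus_eq_zero_iff)
  ultimately have "free_leibniz_ideal K X \<subseteq> ?I"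
    unfolding free_leibniz_ideal_def Let_def by blast
  with c show ?thesis by blast
qed

lemma free_leibniz_extension:
  assumes g: "\<And>x. x \<in> X \<Longrightarrow> g x \<in> carrier L"
  obtains h where "h \<in> leibniz_hom K (free_leibniz K X) L"
    "\<And>x. x \<in> X \<Longrightarrow> h (free_leibniz_ideal K X +>\<^bsub>nonassoc_algebra K X\<^esub> basis_vec K (Gen x)) = g x"
proof -
  interpret A: bilinear_algebra K "nonassoc_algebra K X" by (rule nonassoc_algebra_bilinear)
  obtain h0 where h0: "h0 \<in> leibniz_hom K (nonassoc_algebra K X) L"
    and gen: "\<And>x. x \<in> X \<Longrightarrow> h0 (basis_vec K (Gen x)) = g x"
    using nonassoc_algebra_extension[of X g] g by blast
  obtain h where "h \<in> leibniz_hom K (free_leibniz K X) L"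
    "\<And>c. c \<in> carrier (nonassoc_algebra K X) \<Longrightarrow>
      h (free_leibniz_ideal K X +>\<^bsub>nonassoc_algebra K X\<^esub> c) = h0 c"
    using A.leibniz_quot_factor[OF free_leibniz_ideal_ideal bilinear_algebra_axioms h0
        free_leibniz_ideal_vanish[OF h0]]
    unfolding free_leibniz_def by blast
  moreover have "basis_vec K (Gen x) \<in> carrier (nonassoc_algebra K X)" if "x \<in> X" for x
    using that by (simp add: nonassoc_algebra_simps(1) basis_vec_closed)
  ultimately show thesis using that gen by simp
qed

lemma free_leibniz_hom_eqI:
  assumes h: "h \<in> leibniz_hom K (free_leibniz K X) L"
    and h': "h' \<in> leibniz_hom K (free_leibniz K X) L"
    and gen: "\<And>x. x \<in> X \<Longrightarrow>
      h (free_leibniz_ideal K X +>\<^bsub>nonassoc_algebra K X\<^esub> basis_vec K (Gen x)) =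
      h' (free_leibniz_ideal K X +>\<^bsub>nonassoc_algebra K X\<^esub> basis_vec K (Gen x))"
    and u: "u \<in> carrier (free_leibniz K X)"
  shows "h u = h' u"
proof -
  interpret A: bilinear_algebra K "nonassoc_algebra K X" by (rule nonassoc_algebra_bilinear)
  let ?p = "\<lambda>c. free_leibniz_ideal K X +>\<^bsub>nonassoc_algebra K X\<^esub> c"
  have p: "?p \<in> leibniz_hom K (nonassoc_algebra K X) (free_leibniz K X)"
    unfolding free_leibniz_def by (rule A.leibniz_quot_hom[OF free_leibniz_ideal_ideal])
  obtain c where c: "c \<in> carrier (nonassoc_algebra K X)" "u = ?p c"
    using u by (auto simp: free_leibniz_def A.leibniz_quot_simps)
  have "(h \<circ> ?p) c = (h' \<circ> ?p) c"
    using gen by (intro nonassoc_algebra_hom_eqI[OF leibniz_hom_comp[OF p h]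
        leibniz_hom_comp[OF p h'] _ c(1)]) auto
  with c(2) show ?thesis by simp
qed

end

section \<open>Lie-center and Lie-commutators\<close>

context leibniz_algebra
begin

lemma symmetric_bracket_linear:
  assumes x: "x \<in> carrier L"
  shows "(\<lambda>z. \<langle>x, z\<rangle>\<^bsub>L\<^esub> \<oplus>\<^bsub>L\<^esub> \<langle>z, x\<rangle>\<^bsub>L\<^esub>) \<in> linear_maps K L L"
  unfolding linear_maps_def
proof (intro CollectI conjI ballI)
  fix y z assume "y \<in> carrier L" "z \<in> carrier L"
  then show "\<langle>x, y \<oplus>\<^bsub>L\<^esub> z\<rangle>\<^bsub>L\<^esub> \<oplus>\<^bsub>L\<^esub> \<langle>y \<oplus>\<^bsub>L\<^esub> z, x\<rangle>\<^bsub>L\<^esub> =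
      \<langle>x, y\<rangle>\<^bsub>L\<^esub> \<oplus>\<^bsub>L\<^esub> \<langle>y, x\<rangle>\<^bsub>L\<^esub> \<oplus>\<^bsub>L\<^esub> (\<langle>x, z\<rangle>\<^bsub>L\<^esub> \<oplus>\<^bsub>L\<^esub> \<langle>z, x\<rangle>\<^bsub>L\<^esub>)"
    using x by (simp add: bracket_add_left bracket_add_right bracket_closed L.M.a_ac)
qed (use x in \<open>auto simp: bracket_smult_left bracket_smult_right bracket_closed L.smult_r_distr\<close>)

lemma Lie_center_submodule: "submodule (Lie_center L) K L"
proof -
  note lin = symmetric_bracket_linear
  have ker: "submodule {z \<in> carrier L. \<langle>x, z\<rangle>\<^bsub>L\<^esub> \<oplus>\<^bsub>L\<^esub> \<langle>z, x\<rangle>\<^bsub>L\<^esub> = \<zero>\<^bsub>L\<^esub>} K L" if "x \<in> carrier L" for x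
    using linear_maps_kernel_submodule[OF L.module_axioms L.module_axioms lin[OF that]] .
  show ?thesis
  proof (rule L.submoduleI)
    show "\<zero>\<^bsub>L\<^esub> \<in> Lie_center L"
      using subgroup.one_closed[OF submodule.axioms(1)[OF ker]] by (simp add: Lie_center_def)
  next
    fix a assume "a \<in> Lie_center L"
    then show "\<ominus>\<^bsub>L\<^esub> a \<in> Lie_center L"
      using L.submoduleE(3)[OF ker] by (simp add: Lie_center_def)
  next
    fix a b assume "a \<in> Lie_center L" "b \<in> Lie_center L"
    then show "a \<oplus>\<^bsub>L\<^esub> b \<in> Lie_center L"
      using L.submoduleE(5)[OF ker] by (simp add: Lie_center_def)
  next
    fix k a assume "k \<in> carrier K" "a \<in> Lie_center L"
    then show "k \<odot>\<^bsub>L\<^esub> a \<in> Lie_center L"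
      using L.submoduleE(4)[OF ker] by (simp add: Lie_center_def)
  qed (auto simp: Lie_center_def)
qed

lemma Lie_commutator_memI:
  "m \<in> M \<Longrightarrow> n \<in> N \<Longrightarrow> \<langle>m, n\<rangle>\<^bsub>L\<^esub> \<oplus>\<^bsub>L\<^esub> \<langle>n, m\<rangle>\<^bsub>L\<^esub> \<in> Lie_commutator K L M N"
  unfolding Lie_commutator_def by (rule subsetD[OF L.span_superset]) blast

lemma Lie_commutator_submodule:
  assumes "M \<subseteq> carrier L" "N \<subseteq> carrier L"
  shows "submodule (Lie_commutator K L M N) K L"
  unfolding Lie_commutator_def
  using assms by (intro L.span_submodule) (auto intro!: L.M.a_closed bracket_closed)

lemma Lie_commutator_subsetI:
  assumes "submodule H K L"
    and "\<And>m n. m \<in> M \<Longrightarrow> n \<in> N \<Longrightarrow> \<langle>m, n\<rangle>\<^bsub>L\<^esub> \<oplus>\<^bsub>L\<^esub> \<langle>n, m\<rangle>\<^bsub>L\<^esub> \<in> H"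
  shows "Lie_commutator K L M N \<subseteq> H"
  unfolding Lie_commutator_def using assms by (intro L.span_minimal) auto

text \<open>Left multiplication kills every symmetric bracket, because the Leibniz
  identity expands \<open>[x,[m,n]]\<close> and \<open>[x,[n,m]]\<close> to opposite elements. Right multiplication is a derivation,
  so it maps a symmetric bracket to a sum of two symmetric brackets.\<close>

lemma Lie_commutator_ideal:
  assumes I: "leibniz_ideal K L I"
  shows "leibniz_ideal K L (Lie_commutator K L I (carrier L))"
proof -
  let ?C = "Lie_commutator K L I (carrier L)"
  have I_sub: "I \<subseteq> carrier L"
    using I L.submoduleE(1) by (auto simp: leibniz_ideal_def)
  have C: "submodule ?C K L"
    using I_sub by (rule Lie_commutator_submodule) simp
  have "\<langle>x, c\<rangle>\<^bsub>L\<^esub> \<in> ?C \<and> \<langle>c, x\<rangle>\<^bsub>L\<^esub> \<in> ?C" if x: "x \<in> carrier L" and c: "c \<in> ?C" for x c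
  proof -
    have left: "(\<lambda>y. \<langle>x, y\<rangle>\<^bsub>L\<^esub>) \<in> linear_maps K L L" and right: "(\<lambda>y. \<langle>y, x\<rangle>\<^bsub>L\<^esub>) \<in> linear_maps K L L"
      using x by (auto simp: linear_maps_def bracket_closed bracket_add_left bracket_add_right
          bracket_smult_left bracket_smult_right)
    note vimage = linear_maps_vimage_submodule[OF L.module_axioms L.module_axioms _ C]
    have "?C \<subseteq> {y \<in> carrier L. \<langle>x, y\<rangle>\<^bsub>L\<^esub> \<in> ?C}"
    proof (rule Lie_commutator_subsetI[OF vimage[OF left]])
      fix m n assume "m \<in> I" and n: "n \<in> carrier L"
      then have m: "m \<in> carrier L" using I_sub by blast
      have "\<langle>x, \<langle>m, n\<rangle>\<^bsub>L\<^esub> \<oplus>\<^bsub>L\<^esub> \<langle>n, m\<rangle>\<^bsub>L\<^esub>\<rangle>\<^bsub>L\<^esub> =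
          \<langle>\<langle>x, m\<rangle>\<^bsub>L\<^esub>, n\<rangle>\<^bsub>L\<^esub> \<ominus>\<^bsub>L\<^esub> \<langle>\<langle>x, n\<rangle>\<^bsub>L\<^esub>, m\<rangle>\<^bsub>L\<^esub> \<oplus>\<^bsub>L\<^esub> (\<langle>\<langle>x, n\<rangle>\<^bsub>L\<^esub>, m\<rangle>\<^bsub>L\<^esub> \<ominus>\<^bsub>L\<^esub> \<langle>\<langle>x, m\<rangle>\<^bsub>L\<^esub>, n\<rangle>\<^bsub>L\<^esub>)"
        using x m n by (simp add: bracket_add_right bracket_closed leibniz_identity)
      also have "\<dots> = \<zero>\<^bsub>L\<^esub>"
        using x m n
        by (simp add: L.M.add_diff_add[symmetric] L.M.a_comm L.M.minus_eq_zero_iff bracket_closed)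
      finally show "\<langle>m, n\<rangle>\<^bsub>L\<^esub> \<oplus>\<^bsub>L\<^esub> \<langle>n, m\<rangle>\<^bsub>L\<^esub> \<in> {y \<in> carrier L. \<langle>x, y\<rangle>\<^bsub>L\<^esub> \<in> ?C}"
        using m n subgroup.one_closed[OF submodule.axioms(1)[OF C]] by (simp add: bracket_closed)
    qed
    moreover have "?C \<subseteq> {y \<in> carrier L. \<langle>y, x\<rangle>\<^bsub>L\<^esub> \<in> ?C}"
    proof (rule Lie_commutator_subsetI[OF vimage[OF right]])
      fix m n assume mI: "m \<in> I" and n: "n \<in> carrier L"
      then have m: "m \<in> carrier L" using I_sub by blast
      have derivation: "\<langle>\<langle>a, b\<rangle>\<^bsub>L\<^esub>, x\<rangle>\<^bsub>L\<^esub> = \<langle>a, \<langle>b, x\<rangle>\<^bsub>L\<^esub>\<rangle>\<^bsub>L\<^esub> \<oplus>\<^bsub>L\<^esub> \<langle>\<langle>a, x\<rangle>\<^bsub>L\<^esub>, b\<rangle>\<^bsub>L\<^esub>"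
        if "a \<in> carrier L" "b \<in> carrier L" for a b
        using that x by (simp add: leibniz_identity bracket_closed L.M.minus_eq L.M.a_assoc L.M.l_neg)
      have "\<langle>\<langle>m, n\<rangle>\<^bsub>L\<^esub> \<oplus>\<^bsub>L\<^esub> \<langle>n, m\<rangle>\<^bsub>L\<^esub>, x\<rangle>\<^bsub>L\<^esub> =
          (\<langle>m, \<langle>n, x\<rangle>\<^bsub>L\<^esub>\<rangle>\<^bsub>L\<^esub> \<oplus>\<^bsub>L\<^esub> \<langle>\<langle>n, x\<rangle>\<^bsub>L\<^esub>, m\<rangle>\<^bsub>L\<^esub>) \<oplus>\<^bsub>L\<^esub>
          (\<langle>\<langle>m, x\<rangle>\<^bsub>L\<^esub>, n\<rangle>\<^bsub>L\<^esub> \<oplus>\<^bsub>L\<^esub> \<langle>n, \<langle>m, x\<rangle>\<^bsub>L\<^esub>\<rangle>\<^bsub>L\<^esub>)"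
        using x m n by (simp add: bracket_add_left bracket_closed derivation L.M.a_ac)
      also have "\<dots> \<in> ?C"
        using I mI n x
        by (intro L.submoduleE(5)[OF C] Lie_commutator_memI)
          (auto simp: leibniz_ideal_def bracket_closed)
      finally show "\<langle>m, n\<rangle>\<^bsub>L\<^esub> \<oplus>\<^bsub>L\<^esub> \<langle>n, m\<rangle>\<^bsub>L\<^esub> \<in> {y \<in> carrier L. \<langle>y, x\<rangle>\<^bsub>L\<^esub> \<in> ?C}"
        using m n by (simp add: bracket_closed)
    qed
    ultimately show ?thesis using c by blast
  qed
  with C show ?thesis by (simp add: leibniz_ideal_def)
qed

end

section \<open>The commutator criterion for homology\<close>

text \<open>For a surjection with kernel \<open>R\<close>, let \<open>S\<close> be the preimage of the Lie-center of the codomain.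
  Each of the three conditions turns out to be equivalent to \<open>[S,F] \<subseteq> [R,F]\<close>. Freeness of \<open>F\<close>
  enters later, through the existence of lifts.\<close>

locale leibniz_surjection = F: leibniz_algebra K F + Q: leibniz_algebra K Q
  for K :: "('k, 'r) ring_scheme" and F :: "('k, 'f, 'm) leibniz_scheme"
    and Q :: "('k, 'a, 'n) leibniz_scheme" +
  fixes \<rho> :: "'f \<Rightarrow> 'a"
  assumes hom: "\<rho> \<in> leibniz_hom K F Q" and surj: "\<rho> ` carrier F = carrier Q"
begin

abbreviation "ker \<equiv> a_kernel F Q \<rho>"
abbreviation "center_vimage \<equiv> a_kernel F (center_quot Q) (center_proj Q \<circ> \<rho>)"
abbreviation "ker_commutator \<equiv> Lie_commutator K F ker (carrier F)"
abbreviation "center_commutator \<equiv> Lie_commutator K F center_vimage (carrier F)"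

lemmas linear = leibniz_hom_linear[OF hom]
lemmas rho_simps = linear_maps_closed[OF linear] linear_maps_add[OF linear]
  linear_maps_smult[OF linear] leibniz_hom_bracket[OF hom]
  linear_maps_minus[OF F.L.module_axioms Q.L.module_axioms linear]

lemma surjE:
  assumes "a \<in> carrier Q"
  obtains x where "x \<in> carrier F" "\<rho> x = a"
  using assms unfolding surj[symmetric] by blast

lemma ker_iff: "x \<in> ker \<longleftrightarrow> x \<in> carrier F \<and> \<rho> x = \<zero>\<^bsub>Q\<^esub>"
  by (simp add: a_kernel_def kernel_def)

lemma center_vimage_iff: "x \<in> center_vimage \<longleftrightarrow> x \<in> carrier F \<and> \<rho> x \<in> Lie_center Q"
  using Q.coset_eq_self_iff[OF Q.Lie_center_submodule] rho_simps(1)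
  by (auto simp: a_kernel_def kernel_def center_quot_def center_proj_def Q.leibniz_quot_simps)

lemma ker_ideal: "leibniz_ideal K F ker"
proof -
  have "ker = {x \<in> carrier F. \<rho> x = \<zero>\<^bsub>Q\<^esub>}"
    by (auto simp: ker_iff)
  then have "submodule ker K F"
    using linear_maps_kernel_submodule[OF F.L.module_axioms Q.L.module_axioms linear] by simp
  then show ?thesis
    by (auto simp: leibniz_ideal_def ker_iff F.bracket_closed rho_simps Q.bracket_zero)
qed

lemma ker_commutator_ideal: "leibniz_ideal K F ker_commutator"
  by (rule F.Lie_commutator_ideal[OF ker_ideal])

lemmas ker_submodule = F.ideal_submodule[OF ker_ideal]
lemmas ker_commutator_submodule = F.ideal_submodule[OF ker_commutator_ideal]

lemma center_commutator_submodule: "submodule center_commutator K F"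
  by (rule F.Lie_commutator_submodule) (auto simp: center_vimage_iff)

lemma ker_subset_center_vimage: "ker \<subseteq> center_vimage"
  using subgroup.one_closed[OF submodule.axioms(1)[OF Q.Lie_center_submodule]]
  by (auto simp: ker_iff center_vimage_iff)

lemma ker_commutator_subset: "ker_commutator \<subseteq> center_commutator"
  using ker_subset_center_vimage
  by (intro F.Lie_commutator_subsetI[OF center_commutator_submodule] F.Lie_commutator_memI) auto

lemma center_commutator_subset_ker: "center_commutator \<subseteq> ker"
proof (rule F.Lie_commutator_subsetI[OF ker_submodule])
  fix s y assume s: "s \<in> center_vimage" and y: "y \<in> carrier F"
  then have "\<langle>\<rho> y, \<rho> s\<rangle>\<^bsub>Q\<^esub> \<oplus>\<^bsub>Q\<^esub> \<langle>\<rho> s, \<rho> y\<rangle>\<^bsub>Q\<^esub> = \<zero>\<^bsub>Q\<^esub>"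
    by (simp add: center_vimage_iff Lie_center_def rho_simps)
  then show "\<langle>s, y\<rangle>\<^bsub>F\<^esub> \<oplus>\<^bsub>F\<^esub> \<langle>y, s\<rangle>\<^bsub>F\<^esub> \<in> ker"
    using s y by (simp add: ker_iff center_vimage_iff F.bracket_closed rho_simps Q.L.M.a_comm
        Q.bracket_closed)
qed

lemma center_commutator_subset_iff:
  "center_commutator \<subseteq> ker_commutator \<longleftrightarrow>
    (\<forall>s\<in>center_vimage. \<forall>y\<in>carrier F. \<langle>s, y\<rangle>\<^bsub>F\<^esub> \<oplus>\<^bsub>F\<^esub> \<langle>y, s\<rangle>\<^bsub>F\<^esub> \<in> ker_commutator)"
proof (intro iffI ballI)
  fix s y assume "center_commutator \<subseteq> ker_commutator" and s: "s \<in> center_vimage" and y: "y \<in> carrier F"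
  then show "\<langle>s, y\<rangle>\<^bsub>F\<^esub> \<oplus>\<^bsub>F\<^esub> \<langle>y, s\<rangle>\<^bsub>F\<^esub> \<in> ker_commutator"
    by (rule subsetD[OF _ F.Lie_commutator_memI])
qed (intro F.Lie_commutator_subsetI[OF ker_commutator_submodule], simp)

lemma HL2_carrier:
  "carrier (HL2_Lie K F Q \<rho>) = (\<lambda>x. ker_commutator +>\<^bsub>F\<^esub> x) `
     (ker \<inter> Lie_commutator K F (carrier F) (carrier F))"
  by (auto simp: HL2_Lie_def Let_def quot_space_def A_RCOSETS_def' a_r_coset_def')

lemma HL2_zero: "\<zero>\<^bsub>HL2_Lie K F Q \<rho>\<^esub> = ker_commutator"
  by (simp add: HL2_Lie_def Let_def quot_space_def)

lemma ker_commutator_coset_zero: "ker_commutator +>\<^bsub>F\<^esub> \<zero>\<^bsub>F\<^esub> = ker_commutator"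
  using F.submoduleE(1)[OF ker_commutator_submodule] by simp

lemma zero_in_HL2: "ker_commutator \<in> carrier (HL2_Lie K F Q \<rho>)"
proof -
  have "submodule (Lie_commutator K F (carrier F) (carrier F)) K F"
    by (rule F.Lie_commutator_submodule) simp_all
  then have "\<zero>\<^bsub>F\<^esub> \<in> ker \<inter> Lie_commutator K F (carrier F) (carrier F)"
    using ker_submodule by (auto dest!: submodule.axioms(1) dest: subgroup.one_closed)
  then show ?thesis
    using ker_commutator_coset_zero unfolding HL2_carrier by (metis imageI)
qed

lemma HL2_canonical_map_coset:
  assumes x: "x \<in> carrier F"
  shows "HL2_canonical_map K F Q \<rho> (ker_commutator +>\<^bsub>F\<^esub> x) = center_commutator +>\<^bsub>F\<^esub> x"
  unfolding HL2_canonical_map_def Let_def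
  using F.coset_eq_iff[OF center_commutator_submodule] ker_commutator_subset x
  by (intro F.coset_saturated[OF ker_commutator_submodule x]) blast

text \<open>Since \<open>[S,F]\<close> lies in \<open>R \<inter> [F,F]\<close>, the kernel of the canonical map is all of \<open>[S,F] / [R,F]\<close>.\<close>

lemma HL2_canonical_map_inj_iff:
  "inj_on (HL2_canonical_map K F Q \<rho>) (carrier (HL2_Lie K F Q \<rho>)) \<longleftrightarrow>
    center_commutator \<subseteq> ker_commutator"
proof
  assume inj: "inj_on (HL2_canonical_map K F Q \<rho>) (carrier (HL2_Lie K F Q \<rho>))"
  show "center_commutator \<subseteq> ker_commutator"
  proof
    fix x assume x: "x \<in> center_commutator"
    have "center_commutator \<subseteq> Lie_commutator K F (carrier F) (carrier F)"
      by (intro F.Lie_commutator_subsetI F.Lie_commutator_submodule F.Lie_commutator_memI)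
        (auto simp: center_vimage_iff)
    then have "x \<in> ker \<inter> Lie_commutator K F (carrier F) (carrier F)"
      using x center_commutator_subset_ker by blast
    then have mem: "ker_commutator +>\<^bsub>F\<^esub> x \<in> carrier (HL2_Lie K F Q \<rho>)" and xF: "x \<in> carrier F"
      by (auto simp: HL2_carrier ker_iff)
    have "HL2_canonical_map K F Q \<rho> (ker_commutator +>\<^bsub>F\<^esub> x) = center_commutator"
      using x xF F.coset_eq_self_iff[OF center_commutator_submodule]
      by (simp add: HL2_canonical_map_coset)
    also have "\<dots> = center_commutator +>\<^bsub>F\<^esub> \<zero>\<^bsub>F\<^esub>"
      using F.submoduleE(1)[OF center_commutator_submodule] by simp
    also have "\<dots> = HL2_canonical_map K F Q \<rho> ker_commutator"
      using HL2_canonical_map_coset[OF F.L.M.zero_closed] by (simp add: ker_commutator_coset_zero)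
    finally have "ker_commutator +>\<^bsub>F\<^esub> x = ker_commutator"
      by (rule inj_onD[OF inj _ mem zero_in_HL2])
    then show "x \<in> ker_commutator"
      using F.coset_eq_self_iff[OF ker_commutator_submodule xF] by simp
  qed
next
  assume "center_commutator \<subseteq> ker_commutator"
  then have "center_commutator = ker_commutator"
    using ker_commutator_subset by blast
  then show "inj_on (HL2_canonical_map K F Q \<rho>) (carrier (HL2_Lie K F Q \<rho>))"
    using HL2_canonical_map_coset by (auto simp: inj_on_def HL2_carrier ker_iff)
qed

text \<open>The values of the map on pure tensors are the classes of the generators of \<open>[S,F]\<close>. If all
  of them vanish, then the constant map satisfies the defining formula, whichever representatives
  are chosen, so that the existence of the map comes for free.\<close>

lemma Ganea_map_zero_iff: "Ganea_map_zero K F Q \<rho> \<longleftrightarrow> center_commutator \<subseteq> ker_commutator"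
proof
  assume "Ganea_map_zero K F Q \<rho>"
  then obtain C where C: "is_Ganea_map K F Q \<rho> C"
    and zero: "\<And>t. t \<in> carrier (tensor_space K (Q\<lparr>carrier := Lie_center Q\<rparr>)
      (leibniz_quot Q (leibniz_ann K Q))) \<Longrightarrow> C t = ker_commutator"
    unfolding Ganea_map_zero_def HL2_zero by blast
  have "\<langle>s, y\<rangle>\<^bsub>F\<^esub> \<oplus>\<^bsub>F\<^esub> \<langle>y, s\<rangle>\<^bsub>F\<^esub> \<in> ker_commutator" if s: "s \<in> center_vimage" and y: "y \<in> carrier F" for s y
  proof -
    have "leibniz_ann K Q +>\<^bsub>Q\<^esub> \<rho> y \<in> carrier (leibniz_quot Q (leibniz_ann K Q))"
      using y by (simp add: Q.leibniz_quot_simps rho_simps)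
    then have "C (pure_tensor K (Q\<lparr>carrier := Lie_center Q\<rparr>) (leibniz_quot Q (leibniz_ann K Q))
        (\<rho> s) (leibniz_ann K Q +>\<^bsub>Q\<^esub> \<rho> y)) = ker_commutator"
      using s by (intro zero F.pure_tensor_closed) (simp_all add: center_vimage_iff)
    moreover have "C (pure_tensor K (Q\<lparr>carrier := Lie_center Q\<rparr>) (leibniz_quot Q (leibniz_ann K Q))
        (\<rho> s) (leibniz_ann K Q +>\<^bsub>Q\<^esub> \<rho> y)) =
        ker_commutator +>\<^bsub>F\<^esub> (\<langle>s, y\<rangle>\<^bsub>F\<^esub> \<oplus>\<^bsub>F\<^esub> \<langle>y, s\<rangle>\<^bsub>F\<^esub>)"
      using C s y unfolding is_Ganea_map_def Let_def by blast
    ultimately have "ker_commutator +>\<^bsub>F\<^esub> (\<langle>s, y\<rangle>\<^bsub>F\<^esub> \<oplus>\<^bsub>F\<^esub> \<langle>y, s\<rangle>\<^bsub>F\<^esub>) = ker_commutator"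
      by simp
    then show ?thesis
      using s y F.coset_eq_self_iff[OF ker_commutator_submodule]
      by (simp add: center_vimage_iff F.bracket_closed)
  qed
  then show "center_commutator \<subseteq> ker_commutator"
    using center_commutator_subset_iff by blast
next
  assume sub: "center_commutator \<subseteq> ker_commutator"
  let ?H = "HL2_Lie K F Q \<rho>"
  have "subgroup ker_commutator (add_monoid F)"
    by (rule submodule.axioms(1)[OF ker_commutator_submodule])
  then have add: "ker_commutator <+>\<^bsub>F\<^esub> ker_commutator = ker_commutator"
    by (rule F.L.M.subgroup_add_id)
  have H_add: "ker_commutator \<oplus>\<^bsub>?H\<^esub> ker_commutator = ker_commutator"
    using add by (simp add: HL2_Lie_def Let_def quot_space_def set_add_def')
  have H_smult: "k \<odot>\<^bsub>?H\<^esub> ker_commutator = ker_commutator" if k: "k \<in> carrier K" for k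
  proof -
    have "ker_commutator +>\<^bsub>F\<^esub> (k \<odot>\<^bsub>F\<^esub> x) = ker_commutator" if x: "x \<in> ker_commutator" for x
      using F.submoduleE(1,4)[OF ker_commutator_submodule] k x
        F.coset_eq_self_iff[OF ker_commutator_submodule] by blast
    moreover have "ker_commutator \<noteq> {}"
      using F.submoduleE(2)[OF ker_commutator_submodule] .
    ultimately show ?thesis
      by (auto simp: HL2_Lie_def Let_def quot_space_def a_r_coset_def')
  qed
  have "ker_commutator +>\<^bsub>F\<^esub> (\<langle>s, y\<rangle>\<^bsub>F\<^esub> \<oplus>\<^bsub>F\<^esub> \<langle>y, s\<rangle>\<^bsub>F\<^esub>) = ker_commutator"
    if "s \<in> center_vimage" "y \<in> carrier F" for s y
    using that sub center_commutator_subset_iff F.coset_eq_self_iff[OF ker_commutator_submodule]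
    by (simp add: center_vimage_iff F.bracket_closed)
  then have "is_Ganea_map K F Q \<rho> (\<lambda>t. ker_commutator)"
    by (simp add: is_Ganea_map_def Let_def linear_maps_def zero_in_HL2 H_add H_smult)
  then show "Ganea_map_zero K F Q \<rho>"
    unfolding Ganea_map_zero_def HL2_zero by blast
qed

end

section \<open>The commutator criterion for unicentrality\<close>

context leibniz_surjection
begin

lemma image_Lie_center_subset: "\<rho> ` Lie_center F \<subseteq> Lie_center Q"
proof (rule image_subsetI)
  fix z assume z: "z \<in> Lie_center F"
  then have zF: "z \<in> carrier F" by (simp add: Lie_center_def)
  have "\<langle>x, \<rho> z\<rangle>\<^bsub>Q\<^esub> \<oplus>\<^bsub>Q\<^esub> \<langle>\<rho> z, x\<rangle>\<^bsub>Q\<^esub> = \<zero>\<^bsub>Q\<^esub>" if x: "x \<in> carrier Q" for x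
  proof -
    obtain y where y: "y \<in> carrier F" "\<rho> y = x" by (rule surjE[OF x])
    have "\<rho> (\<langle>y, z\<rangle>\<^bsub>F\<^esub> \<oplus>\<^bsub>F\<^esub> \<langle>z, y\<rangle>\<^bsub>F\<^esub>) = \<rho> \<zero>\<^bsub>F\<^esub>"
      using z y by (simp add: Lie_center_def)
    then show ?thesis
      using linear_maps_zero[OF F.L.module_axioms Q.L.module_axioms linear] y zF
      by (simp add: rho_simps F.bracket_closed)
  qed
  then show "\<rho> z \<in> Lie_center Q"
    using zF rho_simps(1) by (simp add: Lie_center_def)
qed

text \<open>A lift \<open>\<phi>\<close> of the presentation sends \<open>R\<close> into the kernel of \<open>f\<close>, which is Lie-central, so \<open>\<phi>\<close>
  kills \<open>[R,F]\<close> and therefore \<open>[S,F]\<close>. The image of \<open>\<phi>\<close> and the Lie-central kernel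
  of \<open>f\<close> together span \<open>G\<close>. Hence \<open>\<phi> s\<close> is Lie-central for each \<open>s \<in> S\<close>, and it is a preimage of \<open>\<rho> s\<close>.\<close>

lemma image_Lie_center_eq_if_lift:
  assumes ext: "Lie_central_extension K G Q f" and sub: "center_commutator \<subseteq> ker_commutator"
    and \<phi>: "\<phi> \<in> leibniz_hom K F G" and lift: "\<And>x. x \<in> carrier F \<Longrightarrow> f (\<phi> x) = \<rho> x"
  shows "f ` Lie_center G = Lie_center Q"
proof -
  interpret f: leibniz_surjection K G Q f
    using ext by (auto simp: Lie_central_extension_def leibniz_surjection_def
        leibniz_surjection_axioms_def)
  have central: "f.ker \<subseteq> Lie_center G"
    using ext by (simp add: Lie_central_extension_def)
  note phi_lin = leibniz_hom_linear[OF \<phi>]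
  note phi_simps = linear_maps_closed[OF phi_lin] linear_maps_add[OF phi_lin]
    leibniz_hom_bracket[OF \<phi>]
  have phi_ker: "\<phi> x \<in> Lie_center G" if "x \<in> ker" for x
    using that central by (auto simp: ker_iff f.ker_iff phi_simps lift)
  have "ker_commutator \<subseteq> {x \<in> carrier F. \<phi> x = \<zero>\<^bsub>G\<^esub>}"
  proof (rule F.Lie_commutator_subsetI)
    show "submodule {x \<in> carrier F. \<phi> x = \<zero>\<^bsub>G\<^esub>} K F"
      by (rule linear_maps_kernel_submodule[OF F.L.module_axioms f.F.L.module_axioms phi_lin])
    fix r y assume r: "r \<in> ker" and y: "y \<in> carrier F"
    then have rF: "r \<in> carrier F" by (simp add: ker_iff)
    have "\<langle>\<phi> y, \<phi> r\<rangle>\<^bsub>G\<^esub> \<oplus>\<^bsub>G\<^esub> \<langle>\<phi> r, \<phi> y\<rangle>\<^bsub>G\<^esub> = \<zero>\<^bsub>G\<^esub>"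
      using phi_ker[OF r] y by (simp add: Lie_center_def phi_simps)
    then show "\<langle>r, y\<rangle>\<^bsub>F\<^esub> \<oplus>\<^bsub>F\<^esub> \<langle>y, r\<rangle>\<^bsub>F\<^esub> \<in> {x \<in> carrier F. \<phi> x = \<zero>\<^bsub>G\<^esub>}"
      using rF y by (simp add: F.bracket_closed phi_simps f.F.bracket_closed f.F.L.M.a_comm)
  qed
  then have vanish: "\<phi> x = \<zero>\<^bsub>G\<^esub>" if "x \<in> center_commutator" for x
    using that sub by blast
  show ?thesis
  proof
    show "f ` Lie_center G \<subseteq> Lie_center Q"
      by (rule f.image_Lie_center_subset)
    show "Lie_center Q \<subseteq> f ` Lie_center G"
    proof
      fix z assume z: "z \<in> Lie_center Q"
      then have "z \<in> carrier Q" by (simp add: Lie_center_def)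
      then obtain s where s: "s \<in> carrier F" "\<rho> s = z" by (rule surjE)
      then have s_vim: "s \<in> center_vimage" using z by (simp add: center_vimage_iff)
      have "\<langle>y, \<phi> s\<rangle>\<^bsub>G\<^esub> \<oplus>\<^bsub>G\<^esub> \<langle>\<phi> s, y\<rangle>\<^bsub>G\<^esub> = \<zero>\<^bsub>G\<^esub>" if y: "y \<in> carrier G" for y
      proof -
        obtain x where x: "x \<in> carrier F" "\<rho> x = f y"
          by (rule surjE[OF f.rho_simps(1)[OF y]])
        \<comment> \<open>As \<open>y\<close> and \<open>\<phi> x\<close> differ by an element of the Lie-central kernel, they have the same
          symmetric bracket with \<open>\<phi> s\<close>.\<close>
        let ?b = "\<lambda>u. \<langle>\<phi> s, u\<rangle>\<^bsub>G\<^esub> \<oplus>\<^bsub>G\<^esub> \<langle>u, \<phi> s\<rangle>\<^bsub>G\<^esub>"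
        have G: "\<phi> s \<in> carrier G" "\<phi> x \<in> carrier G" using s x by (simp_all add: phi_simps)
        have "f (y \<ominus>\<^bsub>G\<^esub> \<phi> x) = \<zero>\<^bsub>Q\<^esub>"
          using y x G by (simp add: f.rho_simps lift Q.L.M.minus_eq_zero_iff)
        then have "y \<ominus>\<^bsub>G\<^esub> \<phi> x \<in> Lie_center G"
          using central y G by (auto simp: f.ker_iff)
        then have "?b (y \<ominus>\<^bsub>G\<^esub> \<phi> x) = \<zero>\<^bsub>G\<^esub>"
          using G by (simp add: Lie_center_def)
        then have "?b y \<ominus>\<^bsub>G\<^esub> ?b (\<phi> x) = \<zero>\<^bsub>G\<^esub>"
          using linear_maps_minus[OF f.F.L.module_axioms f.F.L.module_axioms
              f.F.symmetric_bracket_linear[OF G(1)] y G(2)] by simp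
        then have "?b y = ?b (\<phi> x)"
          using y G by (simp add: f.F.L.M.minus_eq_zero_iff f.F.bracket_closed)
        also have "\<dots> = \<phi> (\<langle>s, x\<rangle>\<^bsub>F\<^esub> \<oplus>\<^bsub>F\<^esub> \<langle>x, s\<rangle>\<^bsub>F\<^esub>)"
          using s x by (simp add: phi_simps F.bracket_closed)
        also have "\<dots> = \<zero>\<^bsub>G\<^esub>"
          by (rule vanish[OF F.Lie_commutator_memI[OF s_vim x(1)]])
        finally show ?thesis
          using y G by (simp add: f.F.L.M.a_comm f.F.bracket_closed)
      qed
      then have "\<phi> s \<in> Lie_center G"
        using s by (simp add: Lie_center_def phi_simps)
      then show "z \<in> f ` Lie_center G"
        using s lift by (metis imageI)
    qed
  qed
qed

end

text \<open>The test extension is \<open>F / [R,F]\<close>, the largest Lie-central extension that \<open>F\<close> maps onto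
  over \<open>Q\<close>. An element \<open>s \<in> S\<close> agrees modulo \<open>R\<close> with some \<open>z\<close> whose class is Lie-central, that
  is, with \<open>[z,y] + [y,z] \<in> [R,F]\<close> for all \<open>y\<close>; then \<open>s\<close> has the same property.\<close>

lemma center_commutator_subset_if_unicentral:
  fixes F :: "('k, 'f, 'm) leibniz_scheme" and Q :: "('k, 'a) leibniz"
  assumes "leibniz_surjection K F Q \<rho>" and uni: "Lie_unicentral_in TYPE('f set) K Q"
  shows "Lie_commutator K F (a_kernel F (center_quot Q) (center_proj Q \<circ> \<rho>)) (carrier F) \<subseteq>
    Lie_commutator K F (a_kernel F Q \<rho>) (carrier F)"
proof -
  interpret leibniz_surjection K F Q \<rho> by fact
  let ?G = "leibniz_quot F ker_commutator"
  let ?p = "\<lambda>x. ker_commutator +>\<^bsub>F\<^esub> x"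
  note p_hom = F.leibniz_quot_hom[OF ker_commutator_ideal]
  note p_lin = leibniz_hom_linear[OF p_hom]
  note p_simps = linear_maps_add[OF p_lin, symmetric] leibniz_hom_bracket[OF p_hom, symmetric]
  have p_zero_iff: "?p x = \<zero>\<^bsub>?G\<^esub> \<longleftrightarrow> x \<in> ker_commutator" if "x \<in> carrier F" for x
    using F.coset_eq_self_iff[OF ker_commutator_submodule that] by (simp add: F.leibniz_quot_simps)
  have p_center_iff: "?p z \<in> Lie_center ?G \<longleftrightarrow>
      (\<forall>y\<in>carrier F. \<langle>y, z\<rangle>\<^bsub>F\<^esub> \<oplus>\<^bsub>F\<^esub> \<langle>z, y\<rangle>\<^bsub>F\<^esub> \<in> ker_commutator)" if "z \<in> carrier F" for z
    using that
    by (auto simp: Lie_center_def F.leibniz_quot_simps(1) p_simps F.bracket_closed p_zero_iff)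
  have "leibniz_algebra K ?G"
  proof (rule F.leibniz_quot_leibniz[OF ker_commutator_ideal])
    fix x y z assume "x \<in> carrier F" "y \<in> carrier F" "z \<in> carrier F"
    then have "F.leibniz_defect F x y z = \<zero>\<^bsub>F\<^esub>"
      by (simp add: F.leibniz_identity F.bracket_closed F.L.M.minus_eq_zero_iff)
    then show "F.leibniz_defect F x y z \<in> ker_commutator"
      using subgroup.one_closed[OF submodule.axioms(1)[OF ker_commutator_submodule]] by simp
  qed
  have "\<rho> x = \<zero>\<^bsub>Q\<^esub>" if "x \<in> ker_commutator" for x
    using that ker_commutator_subset center_commutator_subset_ker by (auto simp: ker_iff)
  then obtain f where f_hom: "f \<in> leibniz_hom K ?G Q"
    and f: "\<And>x. x \<in> carrier F \<Longrightarrow> f (?p x) = \<rho> x"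
    using F.leibniz_quot_factor[OF ker_commutator_ideal Q.bilinear_algebra_axioms hom] by blast
  have "f ` carrier ?G = carrier Q"
    using f surj by (force simp: F.leibniz_quot_simps(1) image_image)
  moreover have "a_kernel ?G Q f \<subseteq> Lie_center ?G"
  proof
    fix A assume "A \<in> a_kernel ?G Q f"
    then obtain r where r: "r \<in> carrier F" "A = ?p r" "\<rho> r = \<zero>\<^bsub>Q\<^esub>"
      using f by (auto simp: a_kernel_def kernel_def F.leibniz_quot_simps(1))
    then have "\<langle>y, r\<rangle>\<^bsub>F\<^esub> \<oplus>\<^bsub>F\<^esub> \<langle>r, y\<rangle>\<^bsub>F\<^esub> \<in> ker_commutator" if "y \<in> carrier F" for y
      using F.Lie_commutator_memI[of r ker y] that
      by (simp add: ker_iff F.L.M.a_comm F.bracket_closed)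
    then show "A \<in> Lie_center ?G"
      using r p_center_iff by blast
  qed
  ultimately have "Lie_central_extension K ?G Q f"
    using \<open>leibniz_algebra K ?G\<close> f_hom Q.leibniz_algebra_axioms
    by (simp add: Lie_central_extension_def)
  then have image: "f ` Lie_center ?G = Lie_center Q"
    using uni by (simp add: Lie_unicentral_in_def)
  have "\<langle>s, y\<rangle>\<^bsub>F\<^esub> \<oplus>\<^bsub>F\<^esub> \<langle>y, s\<rangle>\<^bsub>F\<^esub> \<in> ker_commutator" if s: "s \<in> center_vimage" and y: "y \<in> carrier F" for s y
  proof -
    have sF: "s \<in> carrier F" and "\<rho> s \<in> f ` Lie_center ?G"
      using s image by (simp_all add: center_vimage_iff)
    then obtain A where A: "A \<in> Lie_center ?G" "f A = \<rho> s" by force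
    then obtain z where z: "z \<in> carrier F" "A = ?p z"
      by (auto simp: Lie_center_def F.leibniz_quot_simps(1))
    let ?b = "\<lambda>u. \<langle>y, u\<rangle>\<^bsub>F\<^esub> \<oplus>\<^bsub>F\<^esub> \<langle>u, y\<rangle>\<^bsub>F\<^esub>"
    note b_lin = F.symmetric_bracket_linear[OF y]
    have "\<rho> (s \<ominus>\<^bsub>F\<^esub> z) = \<zero>\<^bsub>Q\<^esub>"
      using z A f[of z] sF by (simp add: rho_simps Q.L.M.minus_eq_zero_iff)
    then have "s \<ominus>\<^bsub>F\<^esub> z \<in> ker" using sF z by (simp add: ker_iff)
    then have "?b (s \<ominus>\<^bsub>F\<^esub> z) \<in> ker_commutator"
      using F.Lie_commutator_memI[of "s \<ominus>\<^bsub>F\<^esub> z" ker y] y sF z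
      by (simp add: F.L.M.a_comm F.bracket_closed)
    moreover have "?b z \<in> ker_commutator"
      using A z y p_center_iff by blast
    ultimately have "?b (s \<ominus>\<^bsub>F\<^esub> z) \<oplus>\<^bsub>F\<^esub> ?b z \<in> ker_commutator"
      by (rule F.submoduleE(5)[OF ker_commutator_submodule])
    moreover have "?b (s \<ominus>\<^bsub>F\<^esub> z) \<oplus>\<^bsub>F\<^esub> ?b z = ?b ((s \<ominus>\<^bsub>F\<^esub> z) \<oplus>\<^bsub>F\<^esub> z)"
      using linear_maps_add[OF b_lin, of "s \<ominus>\<^bsub>F\<^esub> z" z] sF z by simp
    moreover have "(s \<ominus>\<^bsub>F\<^esub> z) \<oplus>\<^bsub>F\<^esub> z = s"
      using sF z by (simp add: F.L.M.minus_eq F.L.M.a_assoc F.L.M.l_neg)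
    ultimately show ?thesis
      using sF y by (simp add: F.L.M.a_comm F.bracket_closed)
  qed
  then show ?thesis
    using center_commutator_subset_iff by blast
qed

text \<open>Lift the generators, extend to the free Leibniz algebra, and compare on generators.\<close>

lemma free_leibniz_lift:
  assumes ext: "Lie_central_extension K G Q f" and \<rho>: "\<rho> \<in> leibniz_hom K (free_leibniz K X) Q"
  shows "\<exists>\<phi>\<in>leibniz_hom K (free_leibniz K X) G. \<forall>u\<in>carrier (free_leibniz K X). f (\<phi> u) = \<rho> u"
proof -
  interpret leibniz_surjection K G Q f
    using ext by (auto simp: Lie_central_extension_def leibniz_surjection_def
        leibniz_surjection_axioms_def)
  interpret A: bilinear_algebra K "nonassoc_algebra K X" by (rule F.nonassoc_algebra_bilinear)
  let ?gen = "\<lambda>x. free_leibniz_ideal K X +>\<^bsub>nonassoc_algebra K X\<^esub> basis_vec K (Gen x)"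
  have "?gen x \<in> carrier (free_leibniz K X)" if "x \<in> X" for x
    using that
    by (simp add: free_leibniz_def A.leibniz_quot_simps nonassoc_algebra_simps(1) F.basis_vec_closed)
  then have "\<exists>y\<in>carrier G. f y = \<rho> (?gen x)" if "x \<in> X" for x
    using that linear_maps_closed[OF leibniz_hom_linear[OF \<rho>]] by (blast elim: surjE)
  then obtain g where g: "\<And>x. x \<in> X \<Longrightarrow> g x \<in> carrier G" "\<And>x. x \<in> X \<Longrightarrow> f (g x) = \<rho> (?gen x)"
    by metis
  obtain \<phi> where \<phi>: "\<phi> \<in> leibniz_hom K (free_leibniz K X) G" "\<And>x. x \<in> X \<Longrightarrow> \<phi> (?gen x) = g x"
    using F.free_leibniz_extension[of X g] g(1) by blast
  have "(f \<circ> \<phi>) u = \<rho> u" if "u \<in> carrier (free_leibniz K X)" for u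
    by (rule Q.free_leibniz_hom_eqI[OF leibniz_hom_comp[OF \<phi>(1) hom] \<rho> _ that])
      (simp add: \<phi>(2) g(2))
  then show ?thesis using \<phi>(1) by auto
qed

lemma free_presentation_lift:
  fixes F :: "('k, 'f, 'm) leibniz_scheme"
  assumes pres: "free_presentation K F Q \<rho>" and ext: "Lie_central_extension K G Q f"
  shows "\<exists>\<phi>\<in>leibniz_hom K F G. \<forall>x\<in>carrier F. f (\<phi> x) = \<rho> x"
proof -
  interpret G: leibniz_algebra K G using ext by (simp add: Lie_central_extension_def)
  obtain X :: "'f set" and h where h: "h \<in> leibniz_hom K (free_leibniz K X) F"
    and bij: "bij_betw h (carrier (free_leibniz K X)) (carrier F)"
    using pres unfolding free_presentation_def free_on_def by blast
  have \<rho>: "\<rho> \<in> leibniz_hom K F Q"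
    using pres by (simp add: free_presentation_def)
  interpret FX: leibniz_algebra K "free_leibniz K X" by (rule G.free_leibniz_algebra)
  obtain \<psi> where \<psi>: "\<psi> \<in> leibniz_hom K (free_leibniz K X) G"
    and \<psi>_lift: "\<And>u. u \<in> carrier (free_leibniz K X) \<Longrightarrow> f (\<psi> u) = (\<rho> \<circ> h) u"
    using free_leibniz_lift[OF ext leibniz_hom_comp[OF h \<rho>]] by blast
  let ?i = "inv_into (carrier (free_leibniz K X)) h"
  have "\<psi> \<circ> ?i \<in> leibniz_hom K F G"
    by (rule leibniz_hom_comp[OF leibniz_hom_inv_into[OF FX.bilinear_algebra_axioms h bij] \<psi>])
  moreover have "f ((\<psi> \<circ> ?i) x) = \<rho> x" if x: "x \<in> carrier F" for x
  proof -
    have "?i x \<in> carrier (free_leibniz K X)" "h (?i x) = x"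
      using x bij by (auto simp: bij_betw_def inv_into_into f_inv_into_f)
    then show ?thesis by (simp add: \<psi>_lift)
  qed
  ultimately show ?thesis by blast
qed

lemma unicentral_if_center_commutator_subset:
  fixes F :: "('k, 'f, 'm) leibniz_scheme" and Q :: "('k, 'a) leibniz"
  assumes "leibniz_surjection K F Q \<rho>"
    and lift: "\<And>(G :: ('k, 'g) leibniz) f. Lie_central_extension K G Q f \<Longrightarrow>
      \<exists>\<phi>\<in>leibniz_hom K F G. \<forall>x\<in>carrier F. f (\<phi> x) = \<rho> x"
    and sub: "Lie_commutator K F (a_kernel F (center_quot Q) (center_proj Q \<circ> \<rho>)) (carrier F) \<subseteq>
      Lie_commutator K F (a_kernel F Q \<rho>) (carrier F)"
  shows "Lie_unicentral_in TYPE('g) K Q"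
proof -
  interpret leibniz_surjection K F Q \<rho> by fact
  show ?thesis
    unfolding Lie_unicentral_in_def
  proof (intro allI impI)
    fix G :: "('k, 'g) leibniz" and f
    assume ext: "Lie_central_extension K G Q f"
    then obtain \<phi> where "\<phi> \<in> leibniz_hom K F G" "\<And>x. x \<in> carrier F \<Longrightarrow> f (\<phi> x) = \<rho> x"
      using lift by blast
    then show "f ` Lie_center G = Lie_center Q"
      by (rule image_Lie_center_eq_if_lift[OF ext sub])
  qed
qed

text \<open>Taking every element as a generator gives a presentation by a free Leibniz algebra whose type
  depends only on the types of the scalars and of the algebra. It is the presentation to which the
  definition of unicentrality is tailored.\<close>

lemma (in leibniz_algebra) free_leibniz_surjection:
  obtains \<rho> where "leibniz_surjection K (free_leibniz K (carrier L)) L \<rho>"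
proof -
  interpret A: bilinear_algebra K "nonassoc_algebra K (carrier L)" by (rule nonassoc_algebra_bilinear)
  let ?F = "free_leibniz K (carrier L)"
  let ?gen = "\<lambda>x. free_leibniz_ideal K (carrier L) +>\<^bsub>nonassoc_algebra K (carrier L)\<^esub> basis_vec K (Gen x)"
  obtain \<rho> where \<rho>: "\<rho> \<in> leibniz_hom K ?F L" "\<And>x. x \<in> carrier L \<Longrightarrow> \<rho> (?gen x) = x"
    using free_leibniz_extension[of "carrier L" "\<lambda>x. x"] by blast
  have "?gen x \<in> carrier ?F" if "x \<in> carrier L" for x
    using that
    by (simp add: free_leibniz_def A.leibniz_quot_simps nonassoc_algebra_simps(1) basis_vec_closed)
  then have "\<rho> ` carrier ?F = carrier L"
    using \<rho> linear_maps_closed[OF leibniz_hom_linear[OF \<rho>(1)]] by (force simp: image_iff)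
  then show thesis
    using that \<rho>(1) free_leibniz_algebra leibniz_algebra_axioms
    by (auto simp: leibniz_surjection_def leibniz_surjection_axioms_def)
qed

theorem corollary4p10:
  fixes K :: "('k, 'r) ring_scheme"
    and Q :: "('k, 'a) leibniz"
    and F :: "('k, 'f) leibniz"
    and \<rho> :: "'f \<Rightarrow> 'a"
  assumes "leibniz_algebra K Q"
    and "\<one>\<^bsub>K\<^esub> \<oplus>\<^bsub>K\<^esub> \<one>\<^bsub>K\<^esub> \<in> Units K"
    and "free_presentation K F Q \<rho>"
  shows "(Lie_unicentral K Q \<longleftrightarrow> Ganea_map_zero K F Q \<rho>) \<and>
         (Ganea_map_zero K F Q \<rho> \<longleftrightarrow>
            inj_on (HL2_canonical_map K F Q \<rho>) (carrier (HL2_Lie K F Q \<rho>))) \<and>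
         (Lie_unicentral K Q \<longrightarrow> Lie_unicentral_in TYPE('h) K Q)"
proof -
  interpret Q: leibniz_algebra K Q by fact
  interpret P: leibniz_surjection K F Q \<rho>
    using assms(1,3) by (auto simp: free_presentation_def leibniz_surjection_def
        leibniz_surjection_axioms_def)
  let ?F0 = "free_leibniz K (carrier Q)"
  obtain \<rho>0 where \<rho>0: "leibniz_surjection K ?F0 Q \<rho>0"
    by (rule Q.free_leibniz_surjection)
  interpret P0: leibniz_surjection K ?F0 Q \<rho>0 by (rule \<rho>0)
  \<comment> \<open>Unicentrality tests extensions on one type only. The criterion for the canonical presentation
    transports it to the type on which the quotient of \<open>F\<close> lives.\<close>
  have unicentral_iff: "Lie_unicentral K Q \<longleftrightarrow> P.center_commutator \<subseteq> P.ker_commutator"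
  proof
    assume "Lie_unicentral K Q"
    then have "P0.center_commutator \<subseteq> P0.ker_commutator"
      unfolding Lie_unicentral_def by (rule center_commutator_subset_if_unicentral[OF \<rho>0])
    then have "Lie_unicentral_in TYPE('f set) K Q"
      by (intro unicentral_if_center_commutator_subset[OF \<rho>0] free_leibniz_lift[OF _ P0.hom])
    then show "P.center_commutator \<subseteq> P.ker_commutator"
      by (rule center_commutator_subset_if_unicentral[OF P.leibniz_surjection_axioms])
  next
    assume "P.center_commutator \<subseteq> P.ker_commutator"
    then show "Lie_unicentral K Q"
      unfolding Lie_unicentral_def
      by (intro unicentral_if_center_commutator_subset[OF P.leibniz_surjection_axioms]
          free_presentation_lift[OF assms(3)])
  qed
  moreover have "Lie_unicentral_in TYPE('h) K Q" if "P.center_commutator \<subseteq> P.ker_commutator"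
    using that
    by (intro unicentral_if_center_commutator_subset[OF P.leibniz_surjection_axioms]
        free_presentation_lift[OF assms(3)])
  ultimately show ?thesis
    using P.Ganea_map_zero_iff P.HL2_canonical_map_inj_iff by blast
qed

end
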